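(* Let $\mathcal{I}$ be a normed ideal of a $\sigma$-finite, semifinite von Neumann algebra factor $\mathcal{B}$, with ideal norm $\|\cdot\|_{\mathcal{I}}$, endowed with a trace $\tau_{\mathcal{I}}:\mathcal{I}\to\mathbb{C}$ that is positive and $\|\cdot\|_{\mathcal{I}}$-bounded. Assume that $\mathcal{I}^{1/2}$ is a normed ideal with ideal norm $\|\cdot\|_{\mathcal{I}^{1/2}}$ and that $\|AB\|_{\mathcal{I}}\le\|A\|_{\mathcal{I}^{1/2}}\|B\|_{\mathcal{I}^{1/2}}$ for all $A,B\in\mathcal{I}^{1/2}$. Suppose $\tau_{\mathcal{I}}(\mathcal{I}^{3/2})=\{0\}$. Let $H_0=aI$ for some $a\in\mathbb{R}$, and let $V=V^*\in\mathcal{I}^{1/2}$. Let $\mathcal{F}=\operatorname{span}\{\lambda\mapsto(z-\lambda)^{-k}: k\in\mathbb{N},\ \operatorname{Im}(z)<0\}$. Then the measure $\nu_{H_0,V}=\frac12\,\tau_{\mathcal{I}}(V^2)\,\delta_a$ on $\mathbb{R}$ ($\delta_a$ the Dirac measure at $a$) satisfies $$\tau_{\mathcal{I}}\left(f(H_0+V)-f(H_0)-\frac{d}{dt}\bigg|_{t=0}f(H_0+tV)\right)=\int_{\mathbb{R}} f''(\lambda)\,\nu_{H_0,V}(d\lambda)\quad\text{for every } f\in\mathcal{F},$$ and $\|\nu_{H_0,V}\|\le\frac12\,\tau_{\mathcal{I}}(|V|^2)$ (total variation).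
   Context: An ideal of $\mathcal{B}$ means a two-sided ideal. A normed ideal is an ideal $\mathcal{I}$ of $\mathcal{B}$ with an ideal norm, i.e. a norm $\|\cdot\|_{\mathcal{I}}$ on $\mathcal{I}$ such that: (a) $A\in\mathcal{B}$, $B\in\mathcal{I}$, $0\le A\le B$ implies $\|A\|_{\mathcal{I}}\le\|B\|_{\mathcal{I}}$; (b) there is $K>0$ with $\|B\|\le K\|B\|_{\mathcal{I}}$ for all $B\in\mathcal{I}$; (c) $\|ABC\|_{\mathcal{I}}\le\|A\|\,\|B\|_{\mathcal{I}}\,\|C\|$ for $A,C\in\mathcal{B}$, $B\in\mathcal{I}$. A trace on $\mathcal{I}$ is a linear functional $\tau_{\mathcal{I}}:\mathcal{I}\to\mathbb{C}$ with $\tau_{\mathcal{I}}(AB)=\tau_{\mathcal{I}}(BA)$ for $A\in\mathcal{I}$, $B\in\mathcal{B}$; it is positive if $\tau_{\mathcal{I}}(A)\ge 0$ for $0\le A\in\mathcal{I}$, and $\|\cdot\|_{\mathcal{I}}$-bounded if there is $M>0$ with $|\tau_{\mathcal{I}}(A)|\le M\|A\|_{\mathcal{I}}$ for all $A\in\mathcal{I}$. For $\alpha>0$, $\mathcal{I}^\alpha=\{A\in\mathcal{B}:|A|^{1/\alpha}\in\mathcal{I}\}$, an ideal of $\mathcal{B}$, where $|A|=(A^*A)^{1/2}$. For $f(\lambda)=(z-\lambda)^{-k}$, $f(H)=(zI-H)^{-k}$. Derivatives in $t$ are taken in operator norm. *)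

theory Defs
  imports "HOL-Probability.Giry_Monad" "HOL-Computational_Algebra.Polynomial"
begin

section \<open>Complex Hilbert spaces and bounded operators\<close>

text \<open>
  The real inner product inherited from \<^class>\<open>real_inner\<close> is the real part of
  the complex one, so the norm, the topology and completeness are the usual ones, and
  positive definiteness of the complex inner product need not be assumed separately.
  The complex inner product is linear in its first argument.
\<close>

class complex_hilbert = real_inner + banach +
  fixes scaleC :: "complex \<Rightarrow> 'a \<Rightarrow> 'a" (infixr "*\<^sub>C" 75)
    and cinner :: "'a \<Rightarrow> 'a \<Rightarrow> complex"
  assumes scaleC_add_right: "c *\<^sub>C (x + y) = c *\<^sub>C x + c *\<^sub>C y"
    and scaleC_add_left: "(c + d) *\<^sub>C x = c *\<^sub>C x + d *\<^sub>C x"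
    and scaleC_scaleC: "c *\<^sub>C (d *\<^sub>C x) = (c * d) *\<^sub>C x"
    and scaleR_eq_scaleC: "r *\<^sub>R x = complex_of_real r *\<^sub>C x"
    and cinner_add_left: "cinner (x + y) z = cinner x z + cinner y z"
    and cinner_scaleC_left: "cinner (c *\<^sub>C x) y = c * cinner x y"
    and cinner_commute: "cinner x y = cnj (cinner y x)"
    and inner_eq_Re_cinner: "inner x y = Re (cinner x y)"

lemma norm_scaleC: "norm (c *\<^sub>C x) = cmod c * norm (x :: 'a :: complex_hilbert)"
proof -
  have r: "cinner (c *\<^sub>C x) (c *\<^sub>C x) = (c * cnj c) * cinner x x"
    using cinner_commute[of x "c *\<^sub>C x"] cinner_commute[of x x]
    by (simp add: cinner_scaleC_left)
  have "inner (c *\<^sub>C x) (c *\<^sub>C x) = (cmod c)\<^sup>2 * inner x x"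
    unfolding inner_eq_Re_cinner r complex_mult_cnj cmod_power2
    by (simp flip: of_real_power of_real_add)
  then show ?thesis
    by (simp add: norm_eq_sqrt_inner real_sqrt_mult)
qed

text \<open>
  Operators are elements of the library type \<^typ>\<open>'h \<Rightarrow>\<^sub>L 'h\<close> of bounded real-linear
  maps, which supplies the operator norm and topology; \<open>bop\<close> is the set of those that are
  complex-linear, that is, the algebra of all bounded operators on the Hilbert space.
\<close>

type_synonym 'h op = "'h \<Rightarrow>\<^sub>L 'h"

definition bop :: "'h::complex_hilbert op set" where
  "bop = {A. \<forall>c x. blinfun_apply A (c *\<^sub>C x) = c *\<^sub>C blinfun_apply A x}"

lift_definition scaleC_op :: "complex \<Rightarrow> 'h::complex_hilbert op \<Rightarrow> 'h op"
  is "\<lambda>c A x. c *\<^sub>C A x"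
proof -
  fix c :: complex and A :: "'h \<Rightarrow> 'h"
  assume A: "bounded_linear A"
  have "bounded_linear (\<lambda>x::'h. c *\<^sub>C x)"
    by (rule bounded_linear_intro[where K = "cmod c"])
      (simp_all add: scaleC_add_right scaleR_eq_scaleC scaleC_scaleC norm_scaleC mult.commute)
  from bounded_linear_compose[OF this A] show "bounded_linear (\<lambda>x. c *\<^sub>C A x)" .
qed

definition adj :: "'h::complex_hilbert op \<Rightarrow> 'h op" where
  "adj A = (THE T. T \<in> bop \<and>
     (\<forall>x y. cinner (blinfun_apply A x) y = cinner x (blinfun_apply T y)))"

definition positive_op :: "'h::complex_hilbert op \<Rightarrow> bool" where
  "positive_op A \<longleftrightarrow> A \<in> bop \<and> (\<forall>x. cinner (blinfun_apply A x) x \<in> \<real>\<^sub>\<ge>\<^sub>0)"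

definition op_le :: "'h::complex_hilbert op \<Rightarrow> 'h op \<Rightarrow> bool" where
  "op_le A B \<longleftrightarrow> positive_op (B - A)"

definition is_inverse :: "'h::complex_hilbert op \<Rightarrow> 'h op \<Rightarrow> bool" where
  "is_inverse A T \<longleftrightarrow> T \<in> bop \<and> T o\<^sub>L A = id_blinfun \<and> A o\<^sub>L T = id_blinfun"

definition op_inv :: "'h::complex_hilbert op \<Rightarrow> 'h op" where
  "op_inv A = (THE T. is_inverse A T)"

definition op_pow :: "'h::complex_hilbert op \<Rightarrow> nat \<Rightarrow> 'h op" where
  "op_pow A k = (((o\<^sub>L) A) ^^ k) id_blinfun"

definition op_spectrum :: "'h::complex_hilbert op \<Rightarrow> complex set" where
  "op_spectrum A = {z. \<nexists>T. is_inverse (scaleC_op z id_blinfun - A) T}"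

definition poly_op :: "real poly \<Rightarrow> 'h::complex_hilbert op \<Rightarrow> 'h op" where
  "poly_op p A = (\<Sum>i\<le>degree p. coeff p i *\<^sub>R op_pow A i)"

text \<open>
  Continuous functional calculus for self-adjoint \<open>A\<close> and real \<open>f\<close> continuous on the spectrum
  (which is real): the norm limit of \<open>p\<^sub>n(A)\<close> for polynomials \<open>p\<^sub>n\<close> converging to \<open>f\<close>
  uniformly on the spectrum.
\<close>

definition cont_calc :: "(real \<Rightarrow> real) \<Rightarrow> 'h::complex_hilbert op \<Rightarrow> 'h op" where
  "cont_calc f A = (THE T. \<exists>p. uniform_limit {x. complex_of_real x \<in> op_spectrum A}
       (\<lambda>n. poly (p n)) f sequentially \<and> (\<lambda>n. poly_op (p n) A) \<longlonglongrightarrow> T)"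

definition abs_op :: "'h::complex_hilbert op \<Rightarrow> 'h op" where
  "abs_op A = cont_calc sqrt (adj A o\<^sub>L A)"

text \<open>For positive \<open>A\<close> and \<open>r > 0\<close>; note \<^prop>\<open>(0::real) powr r = 0\<close>.\<close>

definition op_powr :: "'h::complex_hilbert op \<Rightarrow> real \<Rightarrow> 'h op" where
  "op_powr A r = cont_calc (\<lambda>x. x powr r) A"


section \<open>Von Neumann algebras\<close>

definition commutant :: "'h::complex_hilbert op set \<Rightarrow> 'h op set" where
  "commutant S = {T \<in> bop. \<forall>A\<in>S. T o\<^sub>L A = A o\<^sub>L T}"

definition von_neumann_algebra :: "'h::complex_hilbert op set \<Rightarrow> bool" where
  "von_neumann_algebra B \<longleftrightarrow>
     B \<subseteq> bop \<and> (\<forall>A\<in>B. adj A \<in> B) \<and> commutant (commutant B) = B"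

definition factor :: "'h::complex_hilbert op set \<Rightarrow> bool" where
  "factor B \<longleftrightarrow> von_neumann_algebra B \<and>
     B \<inter> commutant B = range (\<lambda>c. scaleC_op c id_blinfun)"

definition projections :: "'h::complex_hilbert op set \<Rightarrow> 'h op set" where
  "projections B = {p \<in> B. p o\<^sub>L p = p \<and> adj p = p}"

definition sigma_finite_vna :: "'h::complex_hilbert op set \<Rightarrow> bool" where
  "sigma_finite_vna B \<longleftrightarrow>
     (\<forall>P \<subseteq> projections B - {0}. pairwise (\<lambda>p q. p o\<^sub>L q = 0) P \<longrightarrow> countable P)"

text \<open>
  A projection is finite if it is not Murray-von Neumann equivalent to a proper subprojection.
\<close>

definition finite_projection :: "'h::complex_hilbert op set \<Rightarrow> 'h op \<Rightarrow> bool" where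
  "finite_projection B p \<longleftrightarrow> p \<in> projections B \<and>
     (\<forall>v\<in>B. adj v o\<^sub>L v = p \<and> op_le (v o\<^sub>L adj v) p \<longrightarrow> v o\<^sub>L adj v = p)"

definition semifinite_vna :: "'h::complex_hilbert op set \<Rightarrow> bool" where
  "semifinite_vna B \<longleftrightarrow>
     (\<forall>e \<in> projections (B \<inter> commutant B) - {0}.
        \<exists>p. finite_projection B p \<and> p \<noteq> 0 \<and> op_le p e)"


section \<open>Normed ideals and traces\<close>

definition two_sided_ideal :: "'h::complex_hilbert op set \<Rightarrow> 'h op set \<Rightarrow> bool" where
  "two_sided_ideal B I \<longleftrightarrow> I \<subseteq> B \<and> 0 \<in> I \<and>
     (\<forall>X\<in>I. \<forall>Y\<in>I. X + Y \<in> I) \<and> (\<forall>c. \<forall>X\<in>I. scaleC_op c X \<in> I) \<and>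
     (\<forall>A\<in>B. \<forall>X\<in>I. A o\<^sub>L X \<in> I \<and> X o\<^sub>L A \<in> I)"

definition norm_on :: "'h::complex_hilbert op set \<Rightarrow> ('h op \<Rightarrow> real) \<Rightarrow> bool" where
  "norm_on I N \<longleftrightarrow>
     (\<forall>X\<in>I. 0 \<le> N X \<and> (N X = 0 \<longleftrightarrow> X = 0)) \<and>
     (\<forall>c. \<forall>X\<in>I. N (scaleC_op c X) = cmod c * N X) \<and>
     (\<forall>X\<in>I. \<forall>Y\<in>I. N (X + Y) \<le> N X + N Y)"

definition normed_ideal ::
    "'h::complex_hilbert op set \<Rightarrow> 'h op set \<Rightarrow> ('h op \<Rightarrow> real) \<Rightarrow> bool" where
  "normed_ideal B I N \<longleftrightarrow> two_sided_ideal B I \<and> norm_on I N \<and>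
     (\<forall>X\<in>B. \<forall>Y\<in>I. op_le 0 X \<and> op_le X Y \<longrightarrow> N X \<le> N Y) \<and>
     (\<exists>K>0. \<forall>Y\<in>I. norm Y \<le> K * N Y) \<and>
     (\<forall>X\<in>B. \<forall>Y\<in>I. \<forall>Z\<in>B. N (X o\<^sub>L Y o\<^sub>L Z) \<le> norm X * N Y * norm Z)"

text \<open>A trace is a total function of which only the values on the ideal matter.\<close>

definition trace_on ::
    "'h::complex_hilbert op set \<Rightarrow> 'h op set \<Rightarrow> ('h op \<Rightarrow> complex) \<Rightarrow> bool" where
  "trace_on B I \<tau> \<longleftrightarrow>
     (\<forall>X\<in>I. \<forall>Y\<in>I. \<tau> (X + Y) = \<tau> X + \<tau> Y) \<and>
     (\<forall>c. \<forall>X\<in>I. \<tau> (scaleC_op c X) = c * \<tau> X) \<and>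
     (\<forall>X\<in>I. \<forall>Y\<in>B. \<tau> (X o\<^sub>L Y) = \<tau> (Y o\<^sub>L X))"

definition positive_trace :: "'h::complex_hilbert op set \<Rightarrow> ('h op \<Rightarrow> complex) \<Rightarrow> bool" where
  "positive_trace I \<tau> \<longleftrightarrow> (\<forall>X\<in>I. op_le 0 X \<longrightarrow> \<tau> X \<in> \<real>\<^sub>\<ge>\<^sub>0)"

definition norm_bounded_trace ::
    "'h::complex_hilbert op set \<Rightarrow> ('h op \<Rightarrow> real) \<Rightarrow> ('h op \<Rightarrow> complex) \<Rightarrow> bool" where
  "norm_bounded_trace I N \<tau> \<longleftrightarrow> (\<exists>M>0. \<forall>X\<in>I. cmod (\<tau> X) \<le> M * N X)"

definition ideal_power ::
    "'h::complex_hilbert op set \<Rightarrow> 'h op set \<Rightarrow> real \<Rightarrow> 'h op set" where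
  "ideal_power B I \<alpha> = {X \<in> B. op_powr (abs_op X) (1 / \<alpha>) \<in> I}"


section \<open>The function class and its operator calculus\<close>

text \<open>
  A list of triples \<open>(c, z, k)\<close> encodes the linear combination of the functions
  \<open>\<lambda> \<mapsto> (z - \<lambda>)\<^sup>-\<^sup>k\<close> with coefficients \<open>c\<close>; \<open>k = 0\<close> is allowed.
\<close>

definition admissible :: "(complex \<times> complex \<times> nat) list \<Rightarrow> bool" where
  "admissible ts \<longleftrightarrow> (\<forall>(c, z, k) \<in> set ts. Im z < 0)"

definition comb_fun :: "(complex \<times> complex \<times> nat) list \<Rightarrow> real \<Rightarrow> complex" where
  "comb_fun ts x = (\<Sum>(c, z, k) \<leftarrow> ts. c * inverse (z - complex_of_real x) ^ k)"

definition comb_op ::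
    "(complex \<times> complex \<times> nat) list \<Rightarrow> 'h::complex_hilbert op \<Rightarrow> 'h op" where
  "comb_op ts H =
     (\<Sum>(c, z, k) \<leftarrow> ts. scaleC_op c (op_pow (op_inv (scaleC_op z id_blinfun - H)) k))"

definition resolvent_span :: "(real \<Rightarrow> complex) set" where
  "resolvent_span = {comb_fun ts | ts. admissible ts}"

text \<open>
  \<open>f(H)\<close> for \<open>f\<close> in the span and self-adjoint \<open>H\<close>, by linear extension; it does not depend on
  the chosen representation of \<open>f\<close>.
\<close>

definition fun_op :: "(real \<Rightarrow> complex) \<Rightarrow> 'h::complex_hilbert op \<Rightarrow> 'h op" where
  "fun_op f H = (THE T. \<exists>ts. admissible ts \<and> f = comb_fun ts \<and> T = comb_op ts H)"

definition second_derivative :: "(real \<Rightarrow> complex) \<Rightarrow> real \<Rightarrow> complex" where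
  "second_derivative f x = vector_derivative (\<lambda>y. vector_derivative f (at y)) (at x)"

text \<open>The modulus of the values of the measure is omitted, since they are nonnegative.\<close>

definition total_variation :: "'a measure \<Rightarrow> ennreal" where
  "total_variation \<nu> =
     (SUP P \<in> {P. finite P \<and> P \<subseteq> sets \<nu> \<and> disjoint P \<and> \<Union>P = space \<nu>}. \<Sum>E\<in>P. emeasure \<nu> E)"

end

theory Submission
  imports Defs "HOL-Computational_Algebra.Fundamental_Theorem_Algebra"
begin

text \<open>
  Put \<open>u = (z - a)\<^sup>-\<^sup>1\<close>. Since \<open>H\<^sub>0 = a I\<close> commutes with \<open>V\<close>, the resolvent \<open>R\<close> of
  \<open>H\<^sub>0 + t V\<close> at \<open>z\<close> satisfies \<open>R = u + u t V R\<close>, and iterating this gives, for every \<open>f\<close> in the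
  span, \<open>f(H\<^sub>0 + t V) = f(a) + t f'(a) V + t\<^sup>2 f''(a)/2 V\<^sup>2 + t\<^sup>3 V\<^sup>3 G\<^sub>t\<close>, where \<open>G\<^sub>t\<close> lies in \<open>B\<close>,
  commutes with \<open>V\<close> and is bounded uniformly in \<open>t\<close> (lemma \<open>comb_op_expansion\<close>). The derivative
  at \<open>t = 0\<close> is therefore \<open>f'(a) V\<close>, and the second-order remainder at \<open>t = 1\<close> is
  \<open>f''(a)/2 V\<^sup>2 + V\<^sup>3 G\<^sub>1\<close>. The trace of its first term is the integral of \<open>f''\<close> against
  \<open>1/2 \<tau>(V\<^sup>2) \<delta>\<^sub>a\<close>, so everything rests on \<open>\<tau>(V\<^sup>3 G\<^sub>1) = 0\<close>.

  The trace vanishes on \<open>I\<^sup>3\<^sup>/\<^sup>2\<close>, and deciding membership there needs \<open>|V\<^sup>3 G\<^sub>1|\<^sup>2\<^sup>/\<^sup>3\<close>. The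
  computation is avoided by a polarization (lemma \<open>trace_third_order_zero\<close>): if \<open>S\<close> is
  self-adjoint and commutes with \<open>V\<close>, then \<open>6 V\<^sup>3 S\<close> is a combination of cubes \<open>U\<^sup>3\<close> of
  self-adjoint elements \<open>U\<close> of the ideal \<open>I\<^sup>1\<^sup>/\<^sup>2\<close>, for which simply \<open>|U\<^sup>3|\<^sup>2\<^sup>/\<^sup>3 = U\<^sup>2 \<in> I\<close>.

  What remains is the continuous functional calculus for a self-adjoint operator \<open>A\<close>. It comes from
  the bound of \<open>\<parallel>p(A)\<parallel>\<close> by the supremum of \<open>\<bar>p\<bar>\<close> over the spectrum (lemma \<open>norm_poly_op_le\<close>): for
  self-adjoint \<open>T\<close> the operator \<open>\<parallel>T\<parallel>\<^sup>2 - T\<^sup>2\<close> is not bounded below, and factoring the polynomial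
  \<open>\<parallel>p(A)\<parallel>\<^sup>2 - p\<^sup>2\<close> turns this for \<open>T = p(A)\<close> into a spectral point of \<open>A\<close>. Together with the
  Weierstrass theorem this shows that limits of \<open>p\<^sub>n(A)\<close> exist, are unique and multiplicative.
  Adjoints come from the Riesz representation theorem, resolvents from the Lax-Milgram argument.
\<close>

section \<open>The complex inner product and the adjoint\<close>

lemma cinner_scaleC_right: "cinner x (c *\<^sub>C y) = cnj c * cinner x (y :: 'h::complex_hilbert)"
  by (metis cinner_commute cinner_scaleC_left complex_cnj_mult)

lemma cinner_self: "cinner x (x :: 'h::complex_hilbert) = of_real ((norm x)\<^sup>2)"
proof -
  have "cnj (cinner x x) = cinner x x"
    using cinner_commute[of x x] by simp
  then have "Im (cinner x x) = 0"
    by (metis complex_cnj_cancel_iff complex_is_Real_iff Reals_cnj_iff)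
  then show ?thesis
    by (simp add: complex_eq_iff power2_norm_eq_inner inner_eq_Re_cinner)
qed

text \<open>Multiplying by \<open>\<i>\<close> exchanges real and imaginary parts, so identities between complex
  inner products of complex-linear maps can be checked on the real inner product.\<close>

lemma cinner_eq_inner:
  "cinner x y = Complex (inner x y) (inner x (\<i> *\<^sub>C (y :: 'h::complex_hilbert)))"
  by (simp add: complex_eq_iff inner_eq_Re_cinner cinner_scaleC_right)

lemma scaleC_one [simp]: "1 *\<^sub>C x = (x :: 'h::complex_hilbert)"
  using scaleR_eq_scaleC[of 1 x] by simp

lemma scaleC_zero_left [simp]: "0 *\<^sub>C x = (0 :: 'h::complex_hilbert)"
  using scaleR_eq_scaleC[of 0 x] by simp

lemma scaleC_zero_right [simp]: "c *\<^sub>C 0 = (0 :: 'h::complex_hilbert)"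
  using norm_scaleC[of c "0::'h"] by simp

lemma scaleC_minus_right [simp]: "c *\<^sub>C (- x) = - (c *\<^sub>C (x :: 'h::complex_hilbert))"
  using scaleC_add_right[of c x "- x"] by (simp add: eq_neg_iff_add_eq_0 add.commute)

lemma scaleC_minus_left [simp]: "(- c) *\<^sub>C x = - (c *\<^sub>C (x :: 'h::complex_hilbert))"
  using scaleC_add_left[of c "- c" x] by (simp add: eq_neg_iff_add_eq_0 add.commute)

lemma scaleC_diff_right: "c *\<^sub>C (x - y) = c *\<^sub>C x - c *\<^sub>C (y :: 'h::complex_hilbert)"
  using scaleC_add_right[of c x "- y"] by simp

lemma scaleC_diff_left: "(c - d) *\<^sub>C x = c *\<^sub>C x - d *\<^sub>C (x :: 'h::complex_hilbert)"
  using scaleC_add_left[of c "- d" x] by simp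

lemmas scaleC_simps = scaleC_add_right scaleC_add_left scaleC_diff_right scaleC_diff_left
  scaleC_scaleC scaleR_eq_scaleC

text \<open>A minimizing sequence for \<open>\<parallel>x\<parallel>\<^sup>2 - 2 F x\<close> is Cauchy by the parallelogram law, and
  the first-order condition at its limit says that the limit represents \<open>F\<close>.\<close>

lemma riesz_representation:
  fixes F :: "'a::{real_inner, banach} \<Rightarrow> real"
  assumes "bounded_linear F"
  shows "\<exists>y. \<forall>x. F x = inner y x"
proof -
  interpret F: bounded_linear F by fact
  define J where "J = (\<lambda>x. inner x x - 2 * F x)"
  obtain K where K: "\<And>x. \<bar>F x\<bar> \<le> norm x * K"
    using F.bounded by auto
  have bdd: "bdd_below (range J)"
  proof (rule bdd_belowI2)
    fix x
    have "F x \<le> norm x * K"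
      using K[of x] by linarith
    moreover have "0 \<le> (norm x - K)\<^sup>2"
      by simp
    ultimately show "- (K\<^sup>2) \<le> J x"
      by (simp add: J_def power2_diff flip: power2_norm_eq_inner)
  qed
  define d where "d = Inf (range J)"
  have dle: "d \<le> J x" for x
    unfolding d_def by (intro cInf_lower bdd) simp
  have "\<exists>x. J x < d + 1 / real (Suc n)" for n
  proof -
    have "Inf (range J) < d + 1 / real (Suc n)"
      by (simp add: d_def)
    then show ?thesis
      using cInf_lessD[of "range J"] by auto
  qed
  then obtain s where s: "\<And>n. J (s n) < d + 1 / real (Suc n)"
    by metis
  have par: "(norm (x - y))\<^sup>2 \<le> 2 * (J x - d) + 2 * (J y - d)" for x y
  proof -
    define z where "z = (1/2) *\<^sub>R (x + y)"
    have "(norm (x - y))\<^sup>2 = 2 * J x + 2 * J y - 4 * J z"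
      unfolding J_def z_def power2_norm_eq_inner
      by (simp add: F.add F.scaleR F.diff inner_diff_left inner_diff_right inner_add_left
          inner_add_right inner_commute field_simps)
    then show ?thesis
      using dle[of z] by (simp add: algebra_simps)
  qed
  have "Cauchy s"
  proof (rule CauchyI)
    fix e :: real
    assume e: "e > 0"
    obtain M :: nat where M: "M \<noteq> 0" "inverse (real M) < e\<^sup>2 / 4"
      using real_arch_inverse[of "e\<^sup>2/4"] e by auto
    show "\<exists>M. \<forall>m\<ge>M. \<forall>n\<ge>M. norm (s m - s n) < e"
    proof (intro exI allI impI)
      fix m n
      assume mn: "m \<ge> M" "n \<ge> M"
      have "1 / real (Suc k) < e\<^sup>2 / 4" if "k \<ge> M" for k
      proof -
        have "1 / real (Suc k) \<le> inverse (real M)"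
          using that M(1) by (simp add: field_simps)
        then show ?thesis
          using M(2) by linarith
      qed
      then have "J (s m) - d < e\<^sup>2 / 4" "J (s n) - d < e\<^sup>2 / 4"
        using s mn by (smt (verit, best))+
      then have "2 * (J (s m) - d) + 2 * (J (s n) - d) < e\<^sup>2"
        by simp
      then have "(norm (s m - s n))\<^sup>2 < e\<^sup>2"
        by (rule le_less_trans[OF par])
      then show "norm (s m - s n) < e"
        using e by (meson less_eq_real_def power2_less_imp_less)
    qed
  qed
  then obtain y where y: "s \<longlonglongrightarrow> y"
    using Cauchy_convergent_iff convergent_def by blast
  have "(\<lambda>n. J (s n)) \<longlonglongrightarrow> J y"
    unfolding J_def by (intro tendsto_intros y F.tendsto)
  moreover have "(\<lambda>n. d + 1 / real (Suc n)) \<longlonglongrightarrow> d"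
    using LIMSEQ_inverse_real_of_nat_add[of d] by (simp add: inverse_eq_divide)
  ultimately have "J y \<le> d"
    by (rule LIMSEQ_le) (use s less_imp_le in blast)
  then have min: "J y \<le> J x" for x
    using dle[of x] by linarith
  have "F x = inner y x" for x
  proof -
    define b where "b = inner y x - F x"
    have q: "0 \<le> 2 * t * b + t\<^sup>2 * inner x x" for t
      using min[of "y + t *\<^sub>R x"]
      by (simp add: J_def b_def F.add F.scaleR inner_add_left inner_add_right inner_commute
          algebra_simps power2_eq_square)
    have "b = 0"
    proof (cases "inner x x = 0")
      case True
      then show ?thesis
        using q[of 1] q[of "-1"] by simp
    next
      case False
      then have "inner x x > 0"
        by (simp add: less_le)
      then show ?thesis
        using q[of "- b / inner x x"]
        by (simp add: field_simps power2_eq_square) (smt (verit) mult_eq_0_iff zero_le_square)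
    qed
    then show ?thesis
      by (simp add: b_def)
  qed
  then show ?thesis
    by blast
qed

text \<open>Riesz represents the functional \<open>x \<mapsto> \<langle>A x, y\<rangle>\<close> by a vector \<open>T y\<close>.\<close>

lemma adjoint_exists:
  fixes A :: "'a::{real_inner, banach} \<Rightarrow>\<^sub>L 'a"
  shows "\<exists>T :: 'a \<Rightarrow>\<^sub>L 'a. \<forall>x y. inner (A x) y = inner x (T y)"
proof -
  have "bounded_linear (\<lambda>x. inner (A x) y)" for y
    by (intro bounded_linear_intros)
  then have "\<exists>z. \<forall>x. inner (A x) y = inner z x" for y
    by (rule riesz_representation)
  then obtain g where g: "\<And>x y. inner (A x) y = inner x (g y)"
    by (metis inner_commute)
  have ext: "u = v" if "\<And>x. inner x u = inner x v" for u v :: 'a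
    by (metis that inner_commute vector_eq_ldot)
  have "bounded_linear g"
  proof (rule bounded_linear_intro[where K = "norm A"])
    show "g (x + y) = g x + g y" for x y
      by (rule ext) (simp add: inner_add_right flip: g)
    show "g (r *\<^sub>R x) = r *\<^sub>R g x" for r x
      by (rule ext) (simp flip: g)
    show "norm (g y) \<le> norm y * norm A" for y
    proof (cases "g y = 0")
      case False
      have "norm (g y) * norm (g y) = inner (A (g y)) y"
        by (simp add: g flip: power2_norm_eq_inner power2_eq_square)
      also have "\<dots> \<le> norm (A (g y)) * norm y"
        by (rule norm_cauchy_schwarz)
      also have "\<dots> \<le> norm A * norm (g y) * norm y"
        by (intro mult_right_mono norm_blinfun) simp
      finally show ?thesis
        using False by (simp add: field_simps)
    qed simp
  qed
  then show ?thesis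
    using g by (metis bounded_linear_Blinfun_apply)
qed

lemma bop_scaleC: "A \<in> bop \<Longrightarrow> blinfun_apply A (c *\<^sub>C x) = c *\<^sub>C blinfun_apply A x"
  by (simp add: bop_def)

text \<open>Testing the real adjoint relation on \<open>c x\<close> shows that the adjoint of a complex-linear map
  is complex-linear. The relation for \<open>y\<close> and for \<open>\<i> y\<close> then gives both parts of the complex
  inner product.\<close>

lemma cinner_adjoint:
  fixes A T :: "'h::complex_hilbert op"
  assumes "A \<in> bop" and "\<And>x y. inner (A x) y = inner x (T y)"
  shows "T \<in> bop" and "cinner (A x) y = cinner x (T y)"
proof -
  have ci: "cinner (A x) y = cinner x (T y)" if "T (\<i> *\<^sub>C y) = \<i> *\<^sub>C T y" for x y
    using that by (simp add: cinner_eq_inner assms(2))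
  have re: "Re (cinner (A x) y) = Re (cinner x (T y))" for x y
    using assms(2)[of x y] by (simp add: inner_eq_Re_cinner)
  have "T (c *\<^sub>C y) = c *\<^sub>C T y" for c y
  proof -
    have "inner x (T (c *\<^sub>C y)) = inner x (c *\<^sub>C T y)" for x
    proof -
      have "inner x (T (c *\<^sub>C y)) = Re (cinner (A x) (c *\<^sub>C y))"
        using re[of x "c *\<^sub>C y"] by (simp add: inner_eq_Re_cinner)
      also have "\<dots> = Re (cinner (A (cnj c *\<^sub>C x)) y)"
        by (simp add: bop_scaleC[OF assms(1)] cinner_scaleC_left cinner_scaleC_right)
      also have "\<dots> = Re (cinner x (c *\<^sub>C T y))"
        by (simp add: re cinner_scaleC_left cinner_scaleC_right)
      finally show ?thesis
        by (simp add: inner_eq_Re_cinner)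
    qed
    then show ?thesis
      by (metis inner_commute vector_eq_ldot)
  qed
  then show "T \<in> bop" and "cinner (A x) y = cinner x (T y)"
    using ci by (auto simp: bop_def)
qed

lemma adjoint_unique:
  fixes A T T' :: "'h::complex_hilbert op"
  assumes "\<And>x y. cinner (A x) y = cinner x (T y)" "\<And>x y. cinner (A x) y = cinner x (T' y)"
  shows "T = T'"
proof (rule blinfun_eqI)
  fix y
  have "inner x (T y) = inner x (T' y)" for x
    using assms by (metis inner_eq_Re_cinner)
  then show "T y = T' y"
    by (metis inner_commute vector_eq_ldot)
qed

lemma adj_eqI:
  fixes A T :: "'h::complex_hilbert op"
  assumes "T \<in> bop" "\<And>x y. cinner (A x) y = cinner x (T y)"
  shows "adj A = T"
  unfolding adj_def using assms adjoint_unique by (intro the_equality) blast+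

lemma
  fixes A :: "'h::complex_hilbert op"
  assumes "A \<in> bop"
  shows adj_in_bop: "adj A \<in> bop"
    and cinner_adj: "cinner (A x) y = cinner x (adj A y)"
proof -
  obtain T :: "'h op" where "\<And>x y. inner (A x) y = inner x (T y)"
    using adjoint_exists by blast
  note T = cinner_adjoint[OF assms this]
  have "adj A = T"
    using T by (intro adj_eqI) auto
  then show "adj A \<in> bop" "cinner (A x) y = cinner x (adj A y)"
    using T by auto
qed

text \<open>The real inner product determines the complex one, so symmetry for it suffices. Unlike
  \<^prop>\<open>adj A = A\<close>, this form involves no description operator.\<close>

definition selfadjoint :: "'h::complex_hilbert op \<Rightarrow> bool" where
  "selfadjoint A \<longleftrightarrow> A \<in> bop \<and> (\<forall>x y. inner (A x) y = inner x (A y))"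

lemma selfadjoint_bop: "selfadjoint A \<Longrightarrow> A \<in> bop"
  by (simp add: selfadjoint_def)

lemma selfadjoint_inner: "selfadjoint A \<Longrightarrow> inner (A x) y = inner x (A y)"
  by (simp add: selfadjoint_def)

lemma selfadjoint_adj: "selfadjoint A \<Longrightarrow> adj A = A"
  using adj_eqI cinner_adjoint(2) unfolding selfadjoint_def by metis

lemma selfadjointI: "A \<in> bop \<Longrightarrow> adj A = A \<Longrightarrow> selfadjoint A"
  by (metis cinner_adj inner_eq_Re_cinner selfadjoint_def)


section \<open>The algebra of bounded operators\<close>

lemma blinfun_compose_assoc: "(A o\<^sub>L B) o\<^sub>L C = A o\<^sub>L (B o\<^sub>L C)"
  by (rule blinfun_eqI) simp

lemmas compose_simps = blinfun_compose_assoc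
  bounded_bilinear.add_left[OF bounded_bilinear_blinfun_compose]
  bounded_bilinear.add_right[OF bounded_bilinear_blinfun_compose]
  bounded_bilinear.diff_left[OF bounded_bilinear_blinfun_compose]
  bounded_bilinear.diff_right[OF bounded_bilinear_blinfun_compose]
  bounded_bilinear.scaleR_left[OF bounded_bilinear_blinfun_compose]
  bounded_bilinear.scaleR_right[OF bounded_bilinear_blinfun_compose]

lemma scaleC_op_apply [simp]: "scaleC_op c A x = c *\<^sub>C A x"
  by (simp add: scaleC_op.rep_eq)

lemma scaleC_op_compose_left [simp]: "scaleC_op c A o\<^sub>L X = scaleC_op c (A o\<^sub>L X)"
  by (rule blinfun_eqI) simp

lemma scaleC_op_compose_right:
  "A \<in> bop \<Longrightarrow> A o\<^sub>L scaleC_op c X = scaleC_op c (A o\<^sub>L X)"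
  by (rule blinfun_eqI) (simp add: bop_scaleC)

lemma scaleR_op_eq: "r *\<^sub>R A = scaleC_op (of_real r) (A :: 'h::complex_hilbert op)"
  by (rule blinfun_eqI) (simp add: blinfun.scaleR_left scaleR_eq_scaleC)

lemma scaleC_op_scaleC_op [simp]: "scaleC_op c (scaleC_op d A) = scaleC_op (c * d) A"
  by (rule blinfun_eqI) (simp add: scaleC_scaleC)

lemma scaleC_op_zero [simp]: "scaleC_op c 0 = 0" "scaleC_op 0 A = 0"
  by (rule blinfun_eqI, simp)+

lemma scaleC_op_one [simp]: "scaleC_op 1 A = A"
  by (rule blinfun_eqI) simp

lemma scaleC_op_add_left: "scaleC_op (c + d) A = scaleC_op c A + scaleC_op d A"
  by (rule blinfun_eqI) (simp add: scaleC_add_left blinfun.add_left)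

lemma scaleC_op_add_right: "scaleC_op c (A + X) = scaleC_op c A + scaleC_op c X"
  by (rule blinfun_eqI) (simp add: scaleC_add_right blinfun.add_left)

lemma scaleC_op_sum_right: "scaleC_op c (\<Sum>i\<in>S. f i) = (\<Sum>i\<in>S. scaleC_op c (f i))"
  by (induction S rule: infinite_finite_induct) (simp_all add: scaleC_op_add_right)

lemma norm_scaleC_op_le: "norm (scaleC_op c A) \<le> cmod c * norm A"
proof (rule norm_blinfun_bound)
  show "norm (scaleC_op c A x) \<le> cmod c * norm A * norm x" for x
    using mult_left_mono[OF norm_blinfun[of A x], of "cmod c"] by (simp add: norm_scaleC mult.assoc)
qed simp

lemma id_compose [simp]: "id_blinfun o\<^sub>L A = A" "A o\<^sub>L id_blinfun = A"
  by (rule blinfun_eqI, simp)+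

lemma commutantI: "T \<in> bop \<Longrightarrow> (\<And>A. A \<in> S \<Longrightarrow> T o\<^sub>L A = A o\<^sub>L T) \<Longrightarrow> T \<in> commutant S"
  by (simp add: commutant_def)

lemma commutant_bop: "T \<in> commutant S \<Longrightarrow> T \<in> bop"
  by (simp add: commutant_def)

lemma commutant_comm: "T \<in> commutant S \<Longrightarrow> A \<in> S \<Longrightarrow> T o\<^sub>L A = A o\<^sub>L T"
  by (simp add: commutant_def)

lemma bop_eq_commutant: "bop = commutant {}"
  by (simp add: commutant_def)

lemma id_in_commutant [simp, intro]: "id_blinfun \<in> commutant S"
  by (simp add: commutant_def bop_def)

lemma zero_in_commutant [simp, intro]: "0 \<in> commutant S"
  by (simp add: commutant_def bop_def)

text \<open>A von Neumann algebra is the commutant of its commutant, so its closure under the algebra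
  operations and under inverses is a property of commutants.\<close>

context
  fixes S :: "'h::complex_hilbert op set"
  assumes S: "S \<subseteq> bop"
begin

lemma commutant_add: "X \<in> commutant S \<Longrightarrow> Y \<in> commutant S \<Longrightarrow> X + Y \<in> commutant S"
  by (auto simp: commutant_def bop_def blinfun.add_left scaleC_add_right compose_simps)

lemma commutant_diff: "X \<in> commutant S \<Longrightarrow> Y \<in> commutant S \<Longrightarrow> X - Y \<in> commutant S"
  by (auto simp: commutant_def bop_def blinfun.diff_left scaleC_diff_right compose_simps)

lemma commutant_scaleC: "X \<in> commutant S \<Longrightarrow> scaleC_op c X \<in> commutant S"
  using S by (auto simp: commutant_def scaleC_op_compose_right subset_iff)
     (auto simp: bop_def scaleC_scaleC mult.commute)

lemma commutant_scaleR: "X \<in> commutant S \<Longrightarrow> r *\<^sub>R X \<in> commutant S"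
  by (simp add: scaleR_op_eq commutant_scaleC)

lemma commutant_compose: "X \<in> commutant S \<Longrightarrow> Y \<in> commutant S \<Longrightarrow> X o\<^sub>L Y \<in> commutant S"
  by (auto simp: commutant_def bop_def) (metis blinfun_compose_assoc)

lemma commutant_inverse:
  assumes "X \<in> commutant S" "is_inverse X Y"
  shows "Y \<in> commutant S"
proof (rule commutantI)
  show "Y \<in> bop"
    using assms by (simp add: is_inverse_def)
  fix A
  assume "A \<in> S"
  have "Y o\<^sub>L A = (Y o\<^sub>L A) o\<^sub>L (X o\<^sub>L Y)"
    using assms by (simp add: is_inverse_def)
  also have "\<dots> = Y o\<^sub>L (A o\<^sub>L X) o\<^sub>L Y"
    by (simp add: compose_simps)
  also have "\<dots> = (Y o\<^sub>L X) o\<^sub>L A o\<^sub>L Y"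
    using commutant_comm[OF assms(1) \<open>A \<in> S\<close>] by (simp add: compose_simps)
  finally show "Y o\<^sub>L A = A o\<^sub>L Y"
    using assms by (simp add: is_inverse_def)
qed

end

lemmas bop_add = commutant_add[of "{}", folded bop_eq_commutant, simplified]
  and bop_diff = commutant_diff[of "{}", folded bop_eq_commutant, simplified]
  and bop_scaleC_op = commutant_scaleC[of "{}", folded bop_eq_commutant, simplified]
  and bop_scaleR = commutant_scaleR[of "{}", folded bop_eq_commutant, simplified]
  and bop_compose = commutant_compose[of "{}", folded bop_eq_commutant, simplified]
  and bop_id [simp] = id_in_commutant[of "{}", folded bop_eq_commutant]
  and bop_zero [simp] = zero_in_commutant[of "{}", folded bop_eq_commutant]

lemma selfadjoint_id [simp]: "selfadjoint id_blinfun"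
  by (simp add: selfadjoint_def)

lemma selfadjoint_add: "selfadjoint A \<Longrightarrow> selfadjoint X \<Longrightarrow> selfadjoint (A + X)"
  by (simp add: selfadjoint_def bop_add blinfun.add_left inner_add_left inner_add_right)

lemma selfadjoint_diff: "selfadjoint A \<Longrightarrow> selfadjoint X \<Longrightarrow> selfadjoint (A - X)"
  by (simp add: selfadjoint_def bop_diff blinfun.diff_left inner_diff_left inner_diff_right)

lemma selfadjoint_scaleR: "selfadjoint A \<Longrightarrow> selfadjoint (r *\<^sub>R A)"
  by (simp add: selfadjoint_def bop_scaleR blinfun.scaleR_left)

lemma selfadjoint_compose:
  assumes "selfadjoint A" "selfadjoint X" "A o\<^sub>L X = X o\<^sub>L A"
  shows "selfadjoint (A o\<^sub>L X)"
proof -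
  have "inner (A (X x)) y = inner x (A (X y))" for x y
    using assms(3)[THEN arg_cong, of "\<lambda>T. blinfun_apply T y"] assms(1,2)
    by (simp add: selfadjoint_def)
  then show ?thesis
    using assms by (simp add: selfadjoint_def bop_compose)
qed

lemma selfadjoint_limit:
  assumes "X \<longlonglongrightarrow> T" "\<And>n. selfadjoint (X n)"
  shows "selfadjoint T"
proof -
  have lim: "(\<lambda>n. X n x) \<longlonglongrightarrow> T x" for x
    by (intro tendsto_intros assms)
  have "T (c *\<^sub>C x) = c *\<^sub>C T x" for c x
  proof (rule LIMSEQ_unique)
    show "(\<lambda>n. X n (c *\<^sub>C x)) \<longlonglongrightarrow> T (c *\<^sub>C x)"
      by (rule lim)
    have "(\<lambda>n. scaleC_op c id_blinfun (X n x)) \<longlonglongrightarrow> scaleC_op c id_blinfun (T x)"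
      by (intro tendsto_intros lim)
    then show "(\<lambda>n. X n (c *\<^sub>C x)) \<longlonglongrightarrow> c *\<^sub>C T x"
      using assms(2) by (simp add: bop_scaleC selfadjoint_bop)
  qed
  moreover have "inner (T x) y = inner x (T y)" for x y
  proof (rule LIMSEQ_unique)
    show "(\<lambda>n. inner (X n x) y) \<longlonglongrightarrow> inner (T x) y"
      by (intro tendsto_intros lim)
    show "(\<lambda>n. inner (X n x) y) \<longlonglongrightarrow> inner x (T y)"
      unfolding selfadjoint_inner[OF assms(2)] by (intro tendsto_intros lim)
  qed
  ultimately show ?thesis
    by (simp add: selfadjoint_def bop_def)
qed


section \<open>Inverses of coercive operators\<close>

lemma is_inverse_unique: "is_inverse A T \<Longrightarrow> is_inverse A T' \<Longrightarrow> T = T'"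
  unfolding is_inverse_def by (metis blinfun_compose_assoc id_compose)

lemma op_inv_eq: "is_inverse A T \<Longrightarrow> op_inv A = T"
  unfolding op_inv_def by (blast intro: the_equality is_inverse_unique)

text \<open>For small \<open>\<epsilon> > 0\<close> the map \<open>x \<mapsto> x - \<epsilon> (T x - y)\<close> is a contraction, and its fixed point
  solves \<open>T x = y\<close> (the Lax-Milgram argument).\<close>

lemma coercive_invertible:
  fixes T :: "'h::complex_hilbert op"
  assumes "T \<in> bop" and "v > 0" and coercive: "\<And>x. v * (norm x)\<^sup>2 \<le> inner (T x) x"
  shows "\<exists>S. is_inverse T S"
proof -
  define K where "K = norm T"
  define e where "e = v / (K\<^sup>2 + v\<^sup>2)"
  define q where "q = 1 - v\<^sup>2 / (K\<^sup>2 + v\<^sup>2)"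
  have pos: "K\<^sup>2 + v\<^sup>2 > 0"
    using \<open>v > 0\<close> by (simp add: add_nonneg_pos)
  have "e > 0"
    using pos \<open>v > 0\<close> by (simp add: e_def)
  have q: "0 \<le> q" "q < 1"
    using pos \<open>v > 0\<close> by (auto simp: q_def field_simps)
  \<comment> \<open>The choice of \<open>e\<close> bounds the quadratic term by half of the linear one.\<close>
  have qe: "1 - 2 * e * v + e\<^sup>2 * K\<^sup>2 \<le> q"
  proof -
    have "e\<^sup>2 * K\<^sup>2 \<le> e\<^sup>2 * (K\<^sup>2 + v\<^sup>2)"
      by (intro mult_left_mono) auto
    also have "\<dots> = e * v"
      using pos by (simp add: e_def power2_eq_square)
    finally have "e\<^sup>2 * K\<^sup>2 \<le> e * v" .
    moreover have "q = 1 - e * v"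
      by (simp add: q_def e_def power2_eq_square)
    ultimately show ?thesis
      by simp
  qed
  have contr: "norm (x - e *\<^sub>R T x) \<le> sqrt q * norm x" for x
  proof (rule power2_le_imp_le)
    have "inner (T x) (T x) \<le> K\<^sup>2 * (norm x)\<^sup>2"
      using power_mono[OF norm_blinfun[of T x], of 2]
      by (simp add: K_def power_mult_distrib flip: power2_norm_eq_inner)
    then have "e\<^sup>2 * inner (T x) (T x) \<le> e\<^sup>2 * (K\<^sup>2 * (norm x)\<^sup>2)"
      by (intro mult_left_mono) auto
    moreover have "2 * e * (v * (norm x)\<^sup>2) \<le> 2 * e * inner (T x) x"
      using coercive[of x] \<open>e > 0\<close> by (intro mult_left_mono) auto
    moreover have "(norm (x - e *\<^sub>R T x))\<^sup>2
        = (norm x)\<^sup>2 - 2 * e * inner (T x) x + e\<^sup>2 * inner (T x) (T x)"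
      unfolding power2_norm_eq_inner
      by (simp add: inner_diff_left inner_diff_right inner_commute power2_eq_square algebra_simps)
    ultimately have "(norm (x - e *\<^sub>R T x))\<^sup>2 \<le> (1 - 2 * e * v + e\<^sup>2 * K\<^sup>2) * (norm x)\<^sup>2"
      by (simp add: algebra_simps)
    also have "\<dots> \<le> q * (norm x)\<^sup>2"
      by (intro mult_right_mono qe) simp
    finally show "(norm (x - e *\<^sub>R T x))\<^sup>2 \<le> (sqrt q * norm x)\<^sup>2"
      using q by (simp add: power_mult_distrib)
  qed (use q in simp)
  have "\<exists>x. T x = y" for y
  proof -
    define f where "f = (\<lambda>x. x - e *\<^sub>R (T x - y))"
    have "dist (f x) (f x') \<le> sqrt q * dist x x'" for x x'
      using contr[of "x - x'"]
      by (simp add: f_def dist_norm blinfun.diff_right algebra_simps)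
    then have "\<exists>!x. f x = x"
      using q by (intro banach_fix_type[where c = "sqrt q"]) auto
    then show ?thesis
      using \<open>e > 0\<close> by (auto simp: f_def)
  qed
  then obtain g where g: "\<And>y. T (g y) = y"
    by metis
  have inj: "x = y" if "T x = T y" for x y
  proof -
    have "v * (norm (x - y))\<^sup>2 \<le> 0"
      using coercive[of "x - y"] that by (simp add: blinfun.diff_right)
    then show ?thesis
      using \<open>v > 0\<close> by (simp add: mult_le_0_iff)
  qed
  have bl: "bounded_linear g"
  proof (rule bounded_linear_intro[where K = "1 / v"])
    show "g (x + y) = g x + g y" for x y
      by (rule inj) (simp add: g blinfun.add_right)
    show "g (r *\<^sub>R x) = r *\<^sub>R g x" for r x
      by (rule inj) (simp add: g blinfun.scaleR_right)
    show "norm (g y) \<le> norm y * (1 / v)" for y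
    proof (cases "g y = 0")
      case False
      have "norm (g y) * (v * norm (g y)) \<le> inner y (g y)"
        using coercive[of "g y"] by (simp add: g power2_eq_square algebra_simps)
      also have "\<dots> \<le> norm (g y) * norm y"
        using norm_cauchy_schwarz[of y "g y"] by (simp add: mult.commute)
      finally show ?thesis
        using False \<open>v > 0\<close> by (simp add: field_simps)
    qed (use \<open>v > 0\<close> in simp)
  qed
  have gT: "g (T x) = x" for x
    by (rule inj) (simp add: g)
  have "g (c *\<^sub>C x) = c *\<^sub>C g x" for c x
    by (rule inj) (simp add: g bop_scaleC[OF assms(1)])
  then have "is_inverse T (Blinfun g)"
    by (auto simp: is_inverse_def bop_def bounded_linear_Blinfun_apply[OF bl] g gT
        intro!: blinfun_eqI)
  then show ?thesis ..
qed


section \<open>Polynomials of an operator\<close>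

definition cpoly_op :: "complex poly \<Rightarrow> 'h::complex_hilbert op \<Rightarrow> 'h op" where
  "cpoly_op p A = (\<Sum>i\<le>degree p. scaleC_op (coeff p i) (op_pow A i))"

lemma op_pow_0 [simp]: "op_pow A 0 = id_blinfun"
  and op_pow_Suc [simp]: "op_pow A (Suc k) = A o\<^sub>L op_pow A k"
  by (simp_all add: op_pow_def)

lemma cpoly_op_eq_sum:
  assumes "degree p \<le> n"
  shows "cpoly_op p A = (\<Sum>i\<le>n. scaleC_op (coeff p i) (op_pow A i))"
  unfolding cpoly_op_def using assms
  by (intro sum.mono_neutral_left) (auto simp: coeff_eq_0)

lemma cpoly_op_0 [simp]: "cpoly_op 0 A = 0"
  by (simp add: cpoly_op_def)

lemma cpoly_op_pCons:
  assumes "A \<in> bop"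
  shows "cpoly_op (pCons c p) A = scaleC_op c id_blinfun + (A o\<^sub>L cpoly_op p A)"
proof -
  have "cpoly_op (pCons c p) A
      = (\<Sum>i\<le>Suc (degree p). scaleC_op (coeff (pCons c p) i) (op_pow A i))"
    by (intro cpoly_op_eq_sum degree_pCons_le)
  also have "\<dots> = scaleC_op c id_blinfun
      + (\<Sum>i\<le>degree p. A o\<^sub>L scaleC_op (coeff p i) (op_pow A i))"
    unfolding sum.atMost_Suc_shift by (simp add: scaleC_op_compose_right[OF assms])
  finally show ?thesis
    by (simp add: cpoly_op_def bounded_bilinear.sum_right[OF bounded_bilinear_blinfun_compose])
qed

lemma cpoly_op_add: "cpoly_op (p + q) A = cpoly_op p A + cpoly_op q A"
proof -
  let ?n = "max (degree p) (degree q)"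
  show ?thesis
    using cpoly_op_eq_sum[of "p + q" ?n A] cpoly_op_eq_sum[of p ?n A] cpoly_op_eq_sum[of q ?n A]
    by (simp add: degree_add_le_max scaleC_op_add_left sum.distrib)
qed

lemma cpoly_op_smult: "cpoly_op (smult c p) A = scaleC_op c (cpoly_op p A)"
  using cpoly_op_eq_sum[of "smult c p" "degree p" A]
  by (simp add: degree_smult_le cpoly_op_def scaleC_op_sum_right)

lemma cpoly_op_mult:
  assumes "A \<in> bop"
  shows "cpoly_op (p * q) A = cpoly_op p A o\<^sub>L cpoly_op q A"
  by (induction p)
    (simp_all add: cpoly_op_add cpoly_op_smult cpoly_op_pCons[OF assms] compose_simps)

lemma cpoly_op_power:
  assumes "A \<in> bop"
  shows "cpoly_op (p ^ k) A = op_pow (cpoly_op p A) k"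
  by (induction k)
    (simp_all add: cpoly_op_mult[OF assms] one_pCons cpoly_op_pCons[OF assms])

text \<open>Real polynomials are handled by embedding them into complex ones, which can be factored.\<close>

abbreviation complex_poly :: "real poly \<Rightarrow> complex poly" where
  "complex_poly \<equiv> map_poly complex_of_real"

lemma poly_op_eq_cpoly_op: "poly_op p A = cpoly_op (complex_poly p) A"
  by (simp add: poly_op_def cpoly_op_def coeff_map_poly scaleR_op_eq degree_map_poly)

lemma complex_poly_add: "complex_poly (p + q) = complex_poly p + complex_poly q"
  by (rule poly_eqI) (simp add: coeff_map_poly)

lemma complex_poly_mult: "complex_poly (p * q) = complex_poly p * complex_poly q"
  by (rule poly_eqI) (simp add: coeff_map_poly coeff_mult)

lemma poly_complex_poly: "poly (complex_poly p) (of_real x) = of_real (poly p x)"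
  by (induction p) (simp_all add: map_poly_pCons)

lemma poly_op_add: "poly_op (p + q) A = poly_op p A + poly_op q A"
  by (simp add: poly_op_eq_cpoly_op complex_poly_add cpoly_op_add)

lemma poly_op_mult: "A \<in> bop \<Longrightarrow> poly_op (p * q) A = poly_op p A o\<^sub>L poly_op q A"
  by (simp add: poly_op_eq_cpoly_op complex_poly_mult cpoly_op_mult)

lemma poly_op_0 [simp]: "poly_op 0 A = 0"
  by (simp add: poly_op_eq_cpoly_op)

lemma poly_op_pCons:
  "A \<in> bop \<Longrightarrow> poly_op (pCons c p) A = c *\<^sub>R id_blinfun + (A o\<^sub>L poly_op p A)"
  by (simp add: poly_op_eq_cpoly_op map_poly_pCons cpoly_op_pCons scaleR_op_eq)

lemma poly_op_diff: "poly_op (p - q) A = poly_op p A - poly_op q A"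
  using poly_op_add[of "p - q" q A] by simp

lemma poly_op_commute:
  assumes "A \<in> bop" "A o\<^sub>L X = X o\<^sub>L A"
  shows "poly_op p A o\<^sub>L X = X o\<^sub>L poly_op p A"
proof (induction p)
  case (pCons c p)
  have "(A o\<^sub>L poly_op p A) o\<^sub>L X = A o\<^sub>L (X o\<^sub>L poly_op p A)"
    by (simp add: blinfun_compose_assoc pCons)
  also have "\<dots> = X o\<^sub>L (A o\<^sub>L poly_op p A)"
    by (metis assms(2) blinfun_compose_assoc)
  finally show ?case
    by (simp add: poly_op_pCons[OF assms(1)] compose_simps(2,3,6,7))
qed simp

lemma selfadjoint_poly_op:
  assumes "selfadjoint A"
  shows "selfadjoint (poly_op p A)"
proof (induction p)
  case 0
  then show ?case
    by (simp add: selfadjoint_def)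
next
  case (pCons c p)
  have A: "A \<in> bop"
    by (rule selfadjoint_bop) fact
  then show ?case
    using assms pCons poly_op_commute[of A A p]
    by (auto simp: poly_op_pCons
        intro!: selfadjoint_add selfadjoint_compose selfadjoint_scaleR)
qed

section \<open>The norm of a polynomial in a self-adjoint operator\<close>

definition bounded_below :: "'h::complex_hilbert op \<Rightarrow> bool" where
  "bounded_below A \<longleftrightarrow> (\<exists>\<delta>>0. \<forall>x. \<delta> * norm x \<le> norm (A x))"

lemma bounded_below_compose:
  assumes "bounded_below A" "bounded_below X"
  shows "bounded_below (A o\<^sub>L X)"
proof -
  obtain d e where d: "d > 0" "\<And>x. d * norm x \<le> norm (A x)"
    and e: "e > 0" "\<And>x. e * norm x \<le> norm (X x)"
    using assms by (auto simp: bounded_below_def)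
  have "d * e * norm x \<le> norm (A (X x))" for x
  proof -
    have "d * (e * norm x) \<le> d * norm (X x)"
      using d(1) by (intro mult_left_mono e(2)) simp
    also have "\<dots> \<le> norm (A (X x))"
      by (rule d(2))
    finally show ?thesis
      by (simp add: mult.assoc)
  qed
  then show ?thesis
    using d(1) e(1) by (auto simp: bounded_below_def intro!: exI[of _ "d * e"])
qed

lemma is_inverse_bounded_below:
  assumes "is_inverse A T"
  shows "bounded_below A"
proof -
  have "norm x \<le> (norm T + 1) * norm (A x)" for x
  proof -
    have "x = T (A x)"
      using assms unfolding is_inverse_def
      by (metis blinfun_apply_blinfun_compose blinfun_apply_id_blinfun)
    then have "norm x \<le> norm T * norm (A x)"
      using norm_blinfun[of T "A x"] by simp
    then show ?thesis
      by (simp add: algebra_simps add_increasing)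
  qed
  moreover have "norm T + 1 > 0"
    by (simp add: add_nonneg_pos)
  ultimately show ?thesis
    unfolding bounded_below_def
    by (intro exI[of _ "1 / (norm T + 1)"]) (simp add: field_simps)
qed

lemma bounded_below_minus: "bounded_below (- A) \<longleftrightarrow> bounded_below A"
  by (simp add: bounded_below_def blinfun.minus_left)

text \<open>A complex polynomial splits into linear factors, so \<open>q(A)\<close> can fail to be bounded below
  only if one of the factors \<open>c - A\<close> does.\<close>

lemma bounded_below_cpoly_op:
  assumes "A \<in> bop" "q \<noteq> 0"
    and "\<And>c. poly q c = 0 \<Longrightarrow> bounded_below (scaleC_op c id_blinfun - A)"
  shows "bounded_below (cpoly_op q A)"
  using assms(2,3)
proof (induction "degree q" arbitrary: q rule: less_induct)
  case less
  show ?case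
  proof (cases "degree q = 0")
    case True
    then obtain c where "q = [:c:]"
      by (rule degree_eq_zeroE)
    with less.prems show ?thesis
      by (auto simp: bounded_below_def cpoly_op_pCons[OF assms(1)] norm_scaleC
          intro!: exI[of _ "cmod c"])
  next
    case False
    then obtain c where c: "poly q c = 0"
      using fundamental_theorem_of_algebra[of q] constant_degree[of q] by auto
    then obtain r where r: "q = [:-c, 1:] * r"
      by (metis poly_eq_0_iff_dvd dvdE)
    have "r \<noteq> 0"
      using r less.prems by auto
    then have "degree q = Suc (degree r)"
      unfolding r by (subst degree_mult_eq) auto
    then have "bounded_below (cpoly_op r A)"
      using \<open>r \<noteq> 0\<close> less.prems by (intro less.hyps) (auto simp: r)
    moreover have "cpoly_op [:-c, 1:] A = - (scaleC_op c id_blinfun - A)"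
      by (rule blinfun_eqI) (simp add: cpoly_op_pCons[OF assms(1)] blinfun.bilinear_simps)
    moreover have "bounded_below (scaleC_op c id_blinfun - A)"
      by (rule less.prems) (use c in simp)
    ultimately show ?thesis
      unfolding r cpoly_op_mult[OF assms(1)]
      by (intro bounded_below_compose) (simp_all add: bounded_below_minus del: minus_diff_eq)
  qed
qed

lemma inner_i_right: "inner x (\<i> *\<^sub>C y) = - inner (\<i> *\<^sub>C x) (y :: 'h::complex_hilbert)"
  by (simp add: inner_eq_Re_cinner cinner_scaleC_left cinner_scaleC_right)

lemma selfadjoint_inner_i:
  assumes "selfadjoint A"
  shows "inner (\<i> *\<^sub>C A x) x = 0"
proof -
  have "inner (\<i> *\<^sub>C A x) x = inner (\<i> *\<^sub>C x) (A x)"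
    by (metis assms bop_scaleC selfadjoint_def)
  also have "\<dots> = - inner (\<i> *\<^sub>C A x) x"
    using inner_i_right[of "A x" x] by (simp add: inner_commute)
  finally show ?thesis
    by simp
qed

text \<open>The contribution of \<open>A\<close> to the imaginary part of \<open>\<langle>(c - A) x, x\<rangle>\<close> vanishes. For
  \<open>Im c \<noteq> 0\<close> this makes \<open>c - A\<close> bounded below, and for \<open>Im c < 0\<close> makes \<open>\<i> (c - A)\<close> coercive.\<close>

lemma selfadjoint_shift_inner_i:
  assumes "selfadjoint A"
  shows "inner (\<i> *\<^sub>C (scaleC_op c id_blinfun - A) x) x = - Im c * (norm x)\<^sup>2"
proof -
  have "inner (\<i> *\<^sub>C c *\<^sub>C x) x = Re (\<i> * c * cinner x x)"
    by (simp add: inner_eq_Re_cinner cinner_scaleC_left mult.assoc)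
  also have "\<dots> = - Im c * (norm x)\<^sup>2"
    by (simp add: cinner_self)
  finally show ?thesis
    using selfadjoint_inner_i[OF assms, of x]
    by (simp add: blinfun.diff_left scaleC_diff_right inner_diff_left)
qed

lemma selfadjoint_shift_lower_bound:
  assumes "selfadjoint A"
  shows "\<bar>Im c\<bar> * norm x \<le> norm ((scaleC_op c id_blinfun - A) x)"
proof (cases "x = 0")
  case False
  have "\<bar>Im c\<bar> * (norm x)\<^sup>2 = \<bar>inner (\<i> *\<^sub>C (scaleC_op c id_blinfun - A) x) x\<bar>"
    unfolding selfadjoint_shift_inner_i[OF assms] by (simp add: abs_mult)
  also have "\<dots> \<le> norm ((scaleC_op c id_blinfun - A) x) * norm x"
    using Cauchy_Schwarz_ineq2[of "\<i> *\<^sub>C (scaleC_op c id_blinfun - A) x" x]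
    by (simp add: norm_scaleC)
  finally show ?thesis
    using False by (simp add: power2_eq_square)
qed simp

abbreviation real_spectrum :: "'h::complex_hilbert op \<Rightarrow> real set" where
  "real_spectrum A \<equiv> {x. complex_of_real x \<in> op_spectrum A}"

text \<open>Some linear factor \<open>c - A\<close> of \<open>q(A)\<close> is not bounded below, which for self-adjoint \<open>A\<close>
  forces \<open>c\<close> to be real.\<close>

lemma real_root_in_spectrum:
  assumes "selfadjoint A" "q \<noteq> 0" "\<not> bounded_below (poly_op q A)"
  shows "\<exists>x \<in> real_spectrum A. poly q x = 0"
proof -
  have "complex_poly q \<noteq> 0"
    using assms(2) by (simp add: map_poly_eq_0_iff)
  then obtain c where c: "poly (complex_poly q) c = 0"
      "\<not> bounded_below (scaleC_op c id_blinfun - A)"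
    using bounded_below_cpoly_op[of A "complex_poly q"] assms
    by (auto simp: poly_op_eq_cpoly_op selfadjoint_bop)
  have "Im c = 0"
  proof (rule ccontr)
    assume "Im c \<noteq> 0"
    then have "bounded_below (scaleC_op c id_blinfun - A)"
      using selfadjoint_shift_lower_bound[OF assms(1)]
      by (auto simp: bounded_below_def intro!: exI[of _ "\<bar>Im c\<bar>"])
    with c show False
      by blast
  qed
  then have "c = of_real (Re c)"
    by (simp add: complex_eq_iff)
  moreover have "c \<in> op_spectrum A"
    using c(2) is_inverse_bounded_below by (auto simp: op_spectrum_def)
  ultimately show ?thesis
    using c(1) by (metis mem_Collect_eq of_real_eq_0_iff poly_complex_poly)
qed

text \<open>Unit vectors \<open>x\<close> with \<open>\<parallel>T x\<parallel>\<close> close to \<open>\<parallel>T\<parallel>\<close> are almost eigenvectors of \<open>T\<^sup>2\<close>, because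
  \<open>\<parallel>m\<^sup>2 x - T\<^sup>2 x\<parallel>\<^sup>2 \<le> m\<^sup>2 (m\<^sup>2 - \<parallel>T x\<parallel>\<^sup>2)\<close> for \<open>m = \<parallel>T\<parallel>\<close>.\<close>

lemma norm_square_not_bounded_below:
  fixes T :: "'h::complex_hilbert op"
  assumes "selfadjoint T" and "(x0 :: 'h) \<noteq> 0"
  shows "\<not> bounded_below ((norm T)\<^sup>2 *\<^sub>R id_blinfun - (T o\<^sub>L T))"
proof
  define m where "m = norm T"
  assume "bounded_below ((norm T)\<^sup>2 *\<^sub>R id_blinfun - (T o\<^sub>L T))"
  then obtain d0 where d0: "d0 > 0" "\<And>x. d0 * norm x \<le> norm (m\<^sup>2 *\<^sub>R x - T (T x))"
    by (auto simp: bounded_below_def m_def blinfun.bilinear_simps)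
  show False
  proof (cases "m = 0")
    case True
    then have "T = 0"
      by (simp add: m_def)
    then have "d0 * norm x0 \<le> 0"
      using d0(2)[of x0] True by simp
    then show False
      using d0(1) assms(2) by (simp add: mult_le_0_iff)
  next
    case False
    then have m: "m > 0"
      by (simp add: m_def less_le)
    \<comment> \<open>The cap at \<open>m\<^sup>2\<close> keeps the radicand below nonnegative.\<close>
    define d where "d = min d0 (m\<^sup>2)"
    have d: "d > 0" "d \<le> m\<^sup>2" "\<And>x. d * norm x \<le> norm (m\<^sup>2 *\<^sub>R x - T (T x))"
      using d0(1) m by (simp_all add: d_def order_trans[OF mult_right_mono d0(2)])
    have Tx: "(norm (T x))\<^sup>2 \<le> (m\<^sup>2 - d\<^sup>2 / m\<^sup>2) * (norm x)\<^sup>2" for x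
    proof -
      have "(d * norm x)\<^sup>2 \<le> (norm (m\<^sup>2 *\<^sub>R x - T (T x)))\<^sup>2"
        using d by (intro power_mono) auto
      also have "\<dots> = (m\<^sup>2)\<^sup>2 * (norm x)\<^sup>2 - 2 * m\<^sup>2 * (norm (T x))\<^sup>2 + (norm (T (T x)))\<^sup>2"
        unfolding power2_norm_eq_inner using selfadjoint_inner[OF assms(1), of "T x" x]
        by (simp add: inner_diff_left inner_diff_right inner_commute power2_eq_square
            algebra_simps)
      also have "(norm (T (T x)))\<^sup>2 \<le> m\<^sup>2 * (norm (T x))\<^sup>2"
        using power_mono[OF norm_blinfun[of T "T x"], of 2]
        by (simp add: m_def power_mult_distrib)
      finally have "d\<^sup>2 * (norm x)\<^sup>2 \<le> m\<^sup>2 * (m\<^sup>2 * (norm x)\<^sup>2 - (norm (T x))\<^sup>2)"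
        by (simp add: power_mult_distrib power2_eq_square algebra_simps)
      then show ?thesis
        using m by (simp add: field_simps power2_eq_square)
    qed
    have "d\<^sup>2 / m\<^sup>2 \<le> m\<^sup>2"
      using d m power_mono[of d "m\<^sup>2" 2] by (simp add: field_simps power2_eq_square)
    then have nn: "0 \<le> m\<^sup>2 - d\<^sup>2 / m\<^sup>2"
      by simp
    have "m \<le> sqrt (m\<^sup>2 - d\<^sup>2 / m\<^sup>2)"
      unfolding m_def
    proof (rule norm_blinfun_bound, fold m_def)
      show "norm (T x) \<le> sqrt (m\<^sup>2 - d\<^sup>2 / m\<^sup>2) * norm x" for x
        by (rule power2_le_imp_le) (use Tx[of x] nn in \<open>simp_all add: power_mult_distrib\<close>)
    qed (use nn in simp)
    then have "m\<^sup>2 \<le> m\<^sup>2 - d\<^sup>2 / m\<^sup>2"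
      using m nn by (metis less_imp_le real_sqrt_pow2 power_mono)
    then have "d\<^sup>2 / m\<^sup>2 \<le> 0"
      by simp
    then show False
      using d(1) m by (simp add: divide_le_0_iff power2_eq_square mult_le_0_iff)
  qed
qed

lemma poly_op_X: "A \<in> bop \<Longrightarrow> poly_op [:0, 1:] A = A"
  by (simp add: poly_op_pCons)

lemma norm_square_poly_op:
  assumes "A \<in> bop"
  shows "poly_op ([:r:] - p * p) A = r *\<^sub>R id_blinfun - (poly_op p A o\<^sub>L poly_op p A)"
  by (simp add: poly_op_diff poly_op_mult[OF assms] poly_op_pCons[OF assms])

text \<open>This covers constant polynomials \<open>p\<close> in the norm bound below, where \<open>\<parallel>p(A)\<parallel>\<^sup>2 - p\<^sup>2\<close> is the zero
  polynomial and has no factorization.\<close>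

lemma real_spectrum_nonempty:
  fixes A :: "'h::complex_hilbert op"
  assumes "selfadjoint A" and "(x0 :: 'h) \<noteq> 0"
  shows "real_spectrum A \<noteq> {}"
proof -
  define q :: "real poly" where "q = [:(norm A)\<^sup>2:] - [:0, 1:] * [:0, 1:]"
  have "coeff q 2 = -1"
    by (simp add: q_def numeral_2_eq_2)
  then have "q \<noteq> 0"
    by auto
  moreover have "poly_op q A = (norm A)\<^sup>2 *\<^sub>R id_blinfun - (A o\<^sub>L A)"
    unfolding q_def norm_square_poly_op[OF selfadjoint_bop[OF assms(1)]]
    by (simp add: poly_op_X selfadjoint_bop assms)
  ultimately show ?thesis
    using real_root_in_spectrum[OF assms(1), of q] norm_square_not_bounded_below[OF assms]
    by auto
qed

text \<open>With \<open>m = \<parallel>p(A)\<parallel>\<close>, the operator \<open>m\<^sup>2 - p(A)\<^sup>2\<close> is not bounded below, hence \<open>m\<^sup>2 - p\<^sup>2\<close> has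
  a root in the spectrum of \<open>A\<close>: the norm of \<open>p(A)\<close> is attained by \<open>\<bar>p\<bar>\<close> on the spectrum.\<close>

lemma norm_poly_op_le:
  fixes A :: "'h::complex_hilbert op"
  assumes "selfadjoint A" "e \<ge> 0" and le: "\<And>x. x \<in> real_spectrum A \<Longrightarrow> \<bar>poly p x\<bar> \<le> e"
  shows "norm (poly_op p A) \<le> e"
proof (rule ccontr)
  define m where "m = norm (poly_op p A)"
  assume "\<not> norm (poly_op p A) \<le> e"
  then have m: "m > e"
    by (simp add: m_def)
  have "poly_op p A \<noteq> 0"
    using m assms(2) by (auto simp: m_def)
  then obtain x0 :: 'h where "poly_op p A x0 \<noteq> 0"
    by (metis blinfun_eqI blinfun.zero_left)
  then have x0: "x0 \<noteq> 0"
    by auto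
  define q where "q = [:m\<^sup>2:] - p * p"
  have nbb: "\<not> bounded_below (poly_op q A)"
    unfolding q_def norm_square_poly_op[OF selfadjoint_bop[OF assms(1)]] m_def
    by (rule norm_square_not_bounded_below[OF selfadjoint_poly_op[OF assms(1)] x0])
  have "\<exists>x \<in> real_spectrum A. poly q x = 0"
  proof (cases "q = 0")
    case True
    then show ?thesis
      using real_spectrum_nonempty[OF assms(1) x0] by auto
  qed (use real_root_in_spectrum[OF assms(1) _ nbb] in blast)
  then obtain x where x: "x \<in> real_spectrum A" "m\<^sup>2 = (poly p x)\<^sup>2"
    by (auto simp: q_def power2_eq_square)
  then have "m = \<bar>poly p x\<bar>"
    using m assms(2)
    by (metis abs_of_nonneg less_eq_real_def order_trans power2_eq_iff_nonneg abs_ge_zero power2_abs)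
  then show False
    using le[OF x(1)] m by simp
qed

lemma is_inverse_minus: "is_inverse (- A) T \<Longrightarrow> is_inverse A (- T)"
  using bop_diff[of 0 T]
  by (auto simp: is_inverse_def bounded_bilinear.minus_left[OF bounded_bilinear_blinfun_compose]
      bounded_bilinear.minus_right[OF bounded_bilinear_blinfun_compose])

lemma real_spectrum_ge:
  assumes "A \<in> bop" "x \<in> real_spectrum A" "\<And>y. r * (norm y)\<^sup>2 \<le> inner (A y) y"
  shows "r \<le> x"
proof (rule ccontr)
  assume "\<not> r \<le> x"
  have "\<exists>S. is_inverse (A - scaleC_op (of_real x) id_blinfun) S"
  proof (rule coercive_invertible[where v = "r - x"])
    show "(r - x) * (norm y)\<^sup>2 \<le> inner ((A - scaleC_op (of_real x) id_blinfun) y) y" for y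
      using assms(3)[of y]
      by (simp add: blinfun.diff_left inner_diff_left left_diff_distrib power2_norm_eq_inner
          flip: scaleR_eq_scaleC)
  qed (use \<open>\<not> r \<le> x\<close> in \<open>simp_all add: bop_diff bop_scaleC_op assms(1)\<close>)
  then have "\<exists>S. is_inverse (scaleC_op (of_real x) id_blinfun - A) S"
    by (metis is_inverse_minus minus_diff_eq)
  then show False
    using assms(2) by (simp add: op_spectrum_def)
qed

lemma real_spectrum_le:
  assumes "A \<in> bop" "x \<in> real_spectrum A" "\<And>y. inner (A y) y \<le> r * (norm y)\<^sup>2"
  shows "x \<le> r"
proof (rule ccontr)
  assume "\<not> x \<le> r"
  have "\<exists>S. is_inverse (scaleC_op (of_real x) id_blinfun - A) S"
  proof (rule coercive_invertible[where v = "x - r"])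
    show "(x - r) * (norm y)\<^sup>2 \<le> inner ((scaleC_op (of_real x) id_blinfun - A) y) y" for y
      using assms(3)[of y]
      by (simp add: blinfun.diff_left inner_diff_left left_diff_distrib power2_norm_eq_inner
          flip: scaleR_eq_scaleC)
  qed (use \<open>\<not> x \<le> r\<close> in \<open>simp_all add: bop_diff bop_scaleC_op assms(1)\<close>)
  then show False
    using assms(2) by (simp add: op_spectrum_def)
qed

lemma real_spectrum_subset:
  assumes "A \<in> bop"
  shows "real_spectrum A \<subseteq> {- norm A..norm A}"
proof
  fix x
  assume x: "x \<in> real_spectrum A"
  have "\<bar>inner (A y) y\<bar> \<le> norm A * (norm y)\<^sup>2" for y
  proof -
    have "\<bar>inner (A y) y\<bar> \<le> norm (A y) * norm y"
      by (rule Cauchy_Schwarz_ineq2)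
    also have "\<dots> \<le> (norm A * norm y) * norm y"
      by (intro mult_right_mono norm_blinfun) simp
    finally show ?thesis
      by (simp add: power2_eq_square mult.assoc)
  qed
  then have "- norm A * (norm y)\<^sup>2 \<le> inner (A y) y" "inner (A y) y \<le> norm A * (norm y)\<^sup>2" for y
    by (simp_all add: abs_le_iff minus_le_iff)
  then show "x \<in> {- norm A..norm A}"
    using real_spectrum_ge[OF assms x] real_spectrum_le[OF assms x] by auto
qed


section \<open>Continuous functional calculus\<close>

text \<open>The relation that \<^const>\<open>cont_calc\<close> turns into a function; for self-adjoint \<open>A\<close> it
  is single-valued, and for continuous \<open>f\<close> a limit exists.\<close>

definition calc_limit :: "(real \<Rightarrow> real) \<Rightarrow> 'h::complex_hilbert op \<Rightarrow> 'h op \<Rightarrow> bool" where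
  "calc_limit f A T \<longleftrightarrow> (\<exists>p. uniform_limit (real_spectrum A) (\<lambda>n. poly (p n)) f sequentially \<and>
     (\<lambda>n. poly_op (p n) A) \<longlonglongrightarrow> T)"

lemma calc_limit_unique:
  assumes A: "selfadjoint A" and "calc_limit f A T" "calc_limit f A T'"
  shows "T = T'"
proof -
  obtain p q where p: "uniform_limit (real_spectrum A) (\<lambda>n. poly (p n)) f sequentially"
      "(\<lambda>n. poly_op (p n) A) \<longlonglongrightarrow> T"
    and q: "uniform_limit (real_spectrum A) (\<lambda>n. poly (q n)) f sequentially"
      "(\<lambda>n. poly_op (q n) A) \<longlonglongrightarrow> T'"
    using assms by (auto simp: calc_limit_def)
  have lim: "(\<lambda>n. norm (poly_op (p n - q n) A)) \<longlonglongrightarrow> norm (T - T')"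
    unfolding poly_op_diff by (intro tendsto_intros p q)
  have "norm (T - T') \<le> e" if "e > 0" for e
  proof (rule tendsto_upperbound[OF lim])
    have "\<forall>\<^sub>F n in sequentially. \<forall>x\<in>real_spectrum A. dist (poly (p n) x) (f x) < e / 2"
      "\<forall>\<^sub>F n in sequentially. \<forall>x\<in>real_spectrum A. dist (poly (q n) x) (f x) < e / 2"
      using that by (intro uniform_limitD p q; simp)+
    then show "\<forall>\<^sub>F n in sequentially. norm (poly_op (p n - q n) A) \<le> e"
    proof eventually_elim
      case (elim n)
      show ?case
      proof (rule norm_poly_op_le[OF A])
        fix x
        assume "x \<in> real_spectrum A"
        then show "\<bar>poly (p n - q n) x\<bar> \<le> e"
          using elim by (force simp: dist_real_def abs_real_def split: if_splits)
      qed (use that in simp)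
    qed
  qed simp
  then have "norm (T - T') \<le> 0"
    by (meson dense_le_bounded field_le_epsilon add_0 le_less_linear less_le_not_le)
  then show ?thesis
    by simp
qed

lemma cont_calc_eqI:
  assumes "selfadjoint A" "calc_limit f A T"
  shows "cont_calc f A = T"
proof -
  have "cont_calc f A = (THE T. calc_limit f A T)"
    by (simp add: cont_calc_def calc_limit_def)
  also have "\<dots> = T"
    using assms calc_limit_unique by (intro the_equality) auto
  finally show ?thesis .
qed

lemma real_polynomial_function_poly:
  assumes "real_polynomial_function g"
  shows "\<exists>p. g = poly (p :: real poly)"
proof -
  obtain a n where "g = (\<lambda>x. \<Sum>i\<le>n. a i * x ^ i)"
    using assms by (auto simp: real_polynomial_function_iff_sum)
  then have "g = poly (\<Sum>i\<le>n. monom (a i) i)"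
    by (simp add: poly_sum poly_monom fun_eq_iff)
  then show ?thesis ..
qed

lemma calc_limit_exists:
  assumes A: "selfadjoint A" and f: "continuous_on UNIV f"
  shows "\<exists>T. calc_limit f A T"
proof -
  have "\<exists>p. \<forall>x \<in> real_spectrum A. \<bar>f x - poly p x\<bar> < 1 / real (Suc n)" for n
  proof -
    obtain g where "real_polynomial_function g"
      "\<And>x. x \<in> {- norm A..norm A} \<Longrightarrow> \<bar>f x - g x\<bar> < 1 / real (Suc n)"
      using Stone_Weierstrass_real_polynomial_function[of "{- norm A..norm A}" f "1 / real (Suc n)"]
        continuous_on_subset[OF f] by auto
    then show ?thesis
      using real_polynomial_function_poly real_spectrum_subset[OF selfadjoint_bop[OF A]]
      by (metis subsetD)
  qed
  then obtain p where p: "\<And>n x. x \<in> real_spectrum A \<Longrightarrow> \<bar>f x - poly (p n) x\<bar> < 1 / real (Suc n)"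
    by metis
  have ul: "uniform_limit (real_spectrum A) (\<lambda>n. poly (p n)) f sequentially"
  proof (rule uniform_limitI)
    fix e :: real
    assume "e > 0"
    then have "\<forall>\<^sub>F n in sequentially. 1 / real (Suc n) < e"
      using order_tendstoD(2)[OF LIMSEQ_inverse_real_of_nat, of e]
      by (simp add: inverse_eq_divide)
    then show "\<forall>\<^sub>F n in sequentially. \<forall>x\<in>real_spectrum A. dist (poly (p n) x) (f x) < e"
    proof eventually_elim
      case (elim n)
      then show ?case
        using p[of _ n] by (force simp: dist_real_def abs_minus_commute)
    qed
  qed
  have "Cauchy (\<lambda>n. poly_op (p n) A)"
  proof (rule CauchyI)
    fix e :: real
    assume "e > 0"
    then have "\<forall>\<^sub>F n in sequentially. \<forall>x\<in>real_spectrum A. dist (poly (p n) x) (f x) < e / 4"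
      by (intro uniform_limitD[OF ul]) simp
    then obtain M where M: "\<And>n x. n \<ge> M \<Longrightarrow> x \<in> real_spectrum A \<Longrightarrow> \<bar>poly (p n) x - f x\<bar> < e / 4"
      by (auto simp: eventually_sequentially dist_real_def)
    have "norm (poly_op (p m) A - poly_op (p n) A) < e" if "m \<ge> M" "n \<ge> M" for m n
    proof -
      have "norm (poly_op (p m - p n) A) \<le> e / 2"
      proof (rule norm_poly_op_le[OF A])
        fix x
        assume "x \<in> real_spectrum A"
        from M[OF that(1) this] M[OF that(2) this] show "\<bar>poly (p m - p n) x\<bar> \<le> e / 2"
          by (simp add: abs_real_def split: if_splits)
      qed (use \<open>e > 0\<close> in simp)
      then show ?thesis
        using \<open>e > 0\<close> by (simp add: poly_op_diff)
    qed
    then show "\<exists>M. \<forall>m\<ge>M. \<forall>n\<ge>M. norm (poly_op (p m) A - poly_op (p n) A) < e"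
      by blast
  qed
  then show ?thesis
    using ul by (auto simp: calc_limit_def Cauchy_convergent_iff convergent_def)
qed

lemma cont_calc_limit:
  "selfadjoint A \<Longrightarrow> continuous_on UNIV f \<Longrightarrow> calc_limit f A (cont_calc f A)"
  using calc_limit_exists cont_calc_eqI by metis

lemma cont_calc_cong:
  assumes "\<And>x. x \<in> real_spectrum A \<Longrightarrow> f x = g x"
  shows "cont_calc f A = cont_calc g A"
proof -
  have "uniform_limit (real_spectrum A) h f sequentially \<longleftrightarrow>
      uniform_limit (real_spectrum A) h g sequentially" for h
    using assms by (intro uniform_limit_cong') auto
  then show ?thesis
    by (simp add: cont_calc_def)
qed

lemma cont_calc_ident:
  assumes "selfadjoint A"
  shows "cont_calc (\<lambda>x. x) A = A"
proof (rule cont_calc_eqI[OF assms])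
  show "calc_limit (\<lambda>x. x) A A"
    unfolding calc_limit_def using assms
    by (intro exI[of _ "\<lambda>_. [:0, 1:]"])
      (simp add: poly_op_X selfadjoint_bop uniform_limit_iff)
qed

lemma selfadjoint_cont_calc:
  assumes "selfadjoint A" "continuous_on UNIV f"
  shows "selfadjoint (cont_calc f A)"
  using cont_calc_limit[OF assms] selfadjoint_limit selfadjoint_poly_op[OF assms(1)]
  by (auto simp: calc_limit_def)

lemma cont_calc_commute:
  assumes "selfadjoint A" "continuous_on UNIV f" "A o\<^sub>L X = X o\<^sub>L A"
  shows "cont_calc f A o\<^sub>L X = X o\<^sub>L cont_calc f A"
proof -
  obtain p where p: "(\<lambda>n. poly_op (p n) A) \<longlonglongrightarrow> cont_calc f A"
    using cont_calc_limit[OF assms(1,2)] by (auto simp: calc_limit_def)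
  note tendsto = bounded_bilinear.tendsto[OF bounded_bilinear_blinfun_compose]
  show ?thesis
  proof (rule LIMSEQ_unique)
    show "(\<lambda>n. poly_op (p n) A o\<^sub>L X) \<longlonglongrightarrow> (cont_calc f A o\<^sub>L X)"
      by (intro tendsto p tendsto_const)
    show "(\<lambda>n. poly_op (p n) A o\<^sub>L X) \<longlonglongrightarrow> (X o\<^sub>L cont_calc f A)"
      unfolding poly_op_commute[OF selfadjoint_bop[OF assms(1)] assms(3)]
      by (intro tendsto p tendsto_const)
  qed
qed

lemma cont_calc_mult:
  assumes A: "selfadjoint A" and fg: "continuous_on UNIV f" "continuous_on UNIV g"
  shows "cont_calc (\<lambda>x. f x * g x) A = cont_calc f A o\<^sub>L cont_calc g A"
proof -
  obtain p q where p: "uniform_limit (real_spectrum A) (\<lambda>n. poly (p n)) f sequentially"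
      "(\<lambda>n. poly_op (p n) A) \<longlonglongrightarrow> cont_calc f A"
    and q: "uniform_limit (real_spectrum A) (\<lambda>n. poly (q n)) g sequentially"
      "(\<lambda>n. poly_op (q n) A) \<longlonglongrightarrow> cont_calc g A"
    using cont_calc_limit[OF A] fg by (metis calc_limit_def)
  have bdd: "bounded (h ` real_spectrum A)" if "continuous_on UNIV h" for h :: "real \<Rightarrow> real"
  proof (rule bounded_subset)
    show "bounded (h ` {- norm A..norm A})"
      by (intro compact_imp_bounded compact_continuous_image continuous_on_subset[OF that]) auto
    show "h ` real_spectrum A \<subseteq> h ` {- norm A..norm A}"
      by (intro image_mono real_spectrum_subset selfadjoint_bop A)
  qed
  have "uniform_limit (real_spectrum A) (\<lambda>n. poly (p n * q n)) (\<lambda>x. f x * g x) sequentially"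
    unfolding poly_mult[abs_def] by (intro uniform_lim_mult p q bdd fg)
  moreover have "(\<lambda>n. poly_op (p n * q n) A) \<longlonglongrightarrow> (cont_calc f A o\<^sub>L cont_calc g A)"
    unfolding poly_op_mult[OF selfadjoint_bop[OF A]]
    by (intro bounded_bilinear.tendsto[OF bounded_bilinear_blinfun_compose] p q)
  ultimately have "calc_limit (\<lambda>x. f x * g x) A (cont_calc f A o\<^sub>L cont_calc g A)"
    unfolding calc_limit_def by (intro exI[of _ "\<lambda>n. p n * q n"] conjI)
  then show ?thesis
    by (rule cont_calc_eqI[OF A])
qed

lemma selfadjoint_square: "selfadjoint X \<Longrightarrow> selfadjoint (X o\<^sub>L X)"
  by (simp add: selfadjoint_compose)

lemma square_nonneg: "selfadjoint X \<Longrightarrow> 0 \<le> inner ((X o\<^sub>L X) y) y"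
  by (simp add: selfadjoint_inner[of X "X y" y])

text \<open>The operator \<open>f(A)\<close> is the square of the self-adjoint operator \<open>(\<surd>f)(A)\<close>.\<close>

lemma cont_calc_nonneg:
  assumes A: "selfadjoint A" and f: "continuous_on UNIV f"
    and nonneg: "\<And>x. x \<in> real_spectrum A \<Longrightarrow> 0 \<le> f x"
  shows "0 \<le> inner (cont_calc f A x) x"
proof -
  define S where "S = cont_calc (\<lambda>x. sqrt (f x)) A"
  have c: "continuous_on UNIV (\<lambda>x. sqrt (f x))"
    by (intro continuous_intros f)
  have "cont_calc f A = cont_calc (\<lambda>x. sqrt (f x) * sqrt (f x)) A"
    using nonneg by (intro cont_calc_cong) simp
  also have "\<dots> = S o\<^sub>L S"
    unfolding S_def by (rule cont_calc_mult[OF A c c])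
  finally show ?thesis
    using square_nonneg[OF selfadjoint_cont_calc[OF A c]] by (simp add: S_def)
qed

lemma real_spectrum_nonneg:
  assumes "A \<in> bop" "\<And>y. 0 \<le> inner (A y) y" "x \<in> real_spectrum A"
  shows "0 \<le> x"
  using real_spectrum_ge[OF assms(1,3), of 0] assms(2) by simp


section \<open>Absolute values and powers of self-adjoint operators\<close>

lemma abs_op_eq: "selfadjoint X \<Longrightarrow> abs_op X = cont_calc sqrt (X o\<^sub>L X)"
  by (simp add: abs_op_def selfadjoint_adj)

lemma continuous_sqrt: "continuous_on UNIV sqrt"
  by (intro continuous_intros)

lemma selfadjoint_abs_op: "selfadjoint X \<Longrightarrow> selfadjoint (abs_op X)"
  by (simp add: abs_op_eq selfadjoint_cont_calc selfadjoint_square continuous_sqrt)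

lemma spectrum_square_nonneg:
  "selfadjoint X \<Longrightarrow> x \<in> real_spectrum (X o\<^sub>L X) \<Longrightarrow> 0 \<le> x"
  by (rule real_spectrum_nonneg[OF selfadjoint_bop[OF selfadjoint_square] square_nonneg])

lemma abs_op_square:
  assumes "selfadjoint X"
  shows "abs_op X o\<^sub>L abs_op X = X o\<^sub>L X"
proof -
  have "abs_op X o\<^sub>L abs_op X = cont_calc (\<lambda>x. sqrt x * sqrt x) (X o\<^sub>L X)"
    unfolding abs_op_eq[OF assms]
    by (rule cont_calc_mult[OF selfadjoint_square[OF assms] continuous_sqrt continuous_sqrt, symmetric])
  also have "\<dots> = cont_calc (\<lambda>x. x) (X o\<^sub>L X)"
    using spectrum_square_nonneg[OF assms] by (intro cont_calc_cong) simp
  finally show ?thesis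
    by (simp add: cont_calc_ident selfadjoint_square assms)
qed

lemma spectrum_abs_op_nonneg:
  assumes "selfadjoint X" "x \<in> real_spectrum (abs_op X)"
  shows "0 \<le> x"
proof (rule real_spectrum_nonneg[OF _ _ assms(2)])
  show "abs_op X \<in> bop"
    by (intro selfadjoint_bop selfadjoint_abs_op assms)
  show "0 \<le> inner (abs_op X y) y" for y
    unfolding abs_op_eq[OF assms(1)] using spectrum_square_nonneg[OF assms(1)]
    by (intro cont_calc_nonneg selfadjoint_square assms continuous_sqrt) simp
qed

lemma abs_op_powr_2:
  assumes "selfadjoint X"
  shows "op_powr (abs_op X) 2 = X o\<^sub>L X"
proof -
  have "op_powr (abs_op X) 2 = cont_calc (\<lambda>x. x * x) (abs_op X)"
    unfolding op_powr_def
  proof (rule cont_calc_cong)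
    fix x
    assume "x \<in> real_spectrum (abs_op X)"
    then have "0 \<le> x"
      by (rule spectrum_abs_op_nonneg[OF assms])
    then show "x powr 2 = x * x"
      by (cases "x = 0") (simp_all add: powr_numeral power2_eq_square)
  qed
  also have "\<dots> = abs_op X o\<^sub>L abs_op X"
    using assms by (subst cont_calc_mult)
      (auto simp: cont_calc_ident selfadjoint_abs_op intro!: continuous_intros)
  finally show ?thesis
    by (simp add: abs_op_square assms)
qed

text \<open>With \<open>D = Q - A\<close>, commutativity gives \<open>0 = D (Q\<^sup>2 + Q A + A\<^sup>2)\<close>, and the second factor is
  the sum of squares \<open>(Q + A/2)\<^sup>2 + 3/4 A\<^sup>2\<close>. So \<open>A D = Q D = 0\<close>, hence \<open>D\<^sup>2 = 0\<close>.\<close>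

lemma commuting_cube_inj:
  fixes Q A :: "'h::complex_hilbert op"
  assumes "selfadjoint Q" "selfadjoint A" and comm: "Q o\<^sub>L A = A o\<^sub>L Q"
    and cube: "Q o\<^sub>L Q o\<^sub>L Q = A o\<^sub>L A o\<^sub>L A"
  shows "Q = A"
proof (rule blinfun_eqI)
  fix x
  have c: "Q (A y) = A (Q y)" for y
    using comm[THEN arg_cong, of "\<lambda>T. blinfun_apply T y"] by simp
  have q3: "Q (Q (Q y)) = A (A (A y))" for y
    using cube[THEN arg_cong, of "\<lambda>T. blinfun_apply T y"] by simp
  define y where "y = Q x - A x"
  define u where "u = Q y + (1/2) *\<^sub>R A y"
  note sa = selfadjoint_inner[OF assms(1)] selfadjoint_inner[OF assms(2)]
  have "Q (Q y) + Q (A y) + A (A y) = 0"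
    unfolding y_def by (simp add: blinfun.bilinear_simps c q3)
  then have "inner (Q (Q y) + Q (A y) + A (A y)) y = 0"
    by simp
  moreover have "inner (Q (Q y) + Q (A y) + A (A y)) y
      = inner (Q y) (Q y) + inner (A y) (Q y) + inner (A y) (A y)"
    unfolding inner_add_left sa(1)[of "Q y" y] sa(1)[of "A y" y] sa(2)[of "A y" y] by (rule refl)
  moreover have "inner u u = inner (Q y) (Q y) + inner (A y) (Q y) + inner (A y) (A y) / 4"
    unfolding u_def inner_add_left inner_add_right inner_scaleR_left inner_scaleR_right
      inner_commute[of "Q y" "A y"] by (simp add: add_divide_distrib)
  ultimately have "inner u u + 3/4 * inner (A y) (A y) = 0"
    by linarith
  moreover have "inner u u \<ge> 0" "inner (A y) (A y) \<ge> 0"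
    by simp_all
  ultimately have "inner u u = 0" "inner (A y) (A y) = 0"
    by linarith+
  then have "A y = 0" "Q y = 0"
    by (simp_all add: u_def)
  have "inner y y = inner (Q y) x - inner (A y) x"
    unfolding sa by (subst (2) y_def) (rule inner_diff_right)
  then have "inner y y = 0"
    using \<open>A y = 0\<close> \<open>Q y = 0\<close> by simp
  then show "Q x = A x"
    by (simp add: y_def)
qed

text \<open>The operator \<open>Q = |U\<^sup>3|\<^sup>2\<^sup>/\<^sup>3\<close> satisfies \<open>Q\<^sup>3 = |U\<^sup>3|\<^sup>2 = (U\<^sup>2)\<^sup>3\<close> and commutes with \<open>U\<^sup>2\<close>, so
  injectivity of the cube identifies it without a composition rule for the functional calculus.\<close>

lemma abs_op_cube_powr:
  assumes U: "selfadjoint U"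
  shows "op_powr (abs_op (U o\<^sub>L U o\<^sub>L U)) (2/3) = U o\<^sub>L U"
proof -
  define X where "X = U o\<^sub>L U o\<^sub>L U"
  have X: "selfadjoint X"
    unfolding X_def
    by (rule selfadjoint_compose[OF selfadjoint_square[OF U] U blinfun_compose_assoc])
  define T where "T = abs_op X"
  have T: "selfadjoint T"
    unfolding T_def by (intro selfadjoint_abs_op X)
  \<comment> \<open>The modulus makes continuity on the whole line evident; the spectrum of \<open>T\<close> is nonnegative.\<close>
  define f where "f = (\<lambda>x::real. \<bar>x\<bar> powr (2/3))"
  have f: "continuous_on UNIV f"
    unfolding f_def by (rule continuous_on_powr') (auto intro: continuous_on_rabs)
  define Q where "Q = cont_calc f T"
  have op_powr: "op_powr (abs_op (U o\<^sub>L U o\<^sub>L U)) (2/3) = Q"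
    unfolding op_powr_def X_def[symmetric] T_def[symmetric] Q_def
  proof (rule cont_calc_cong)
    fix x
    assume "x \<in> real_spectrum T"
    then have "0 \<le> x"
      unfolding T_def by (rule spectrum_abs_op_nonneg[OF X])
    then show "x powr (2/3) = f x"
      unfolding f_def by (simp only: abs_of_nonneg)
  qed
  have "Q o\<^sub>L Q o\<^sub>L Q = cont_calc (\<lambda>x. f x * f x * f x) T"
    unfolding Q_def
    by (simp only: cont_calc_mult[OF T continuous_on_mult[OF f f] f] cont_calc_mult[OF T f f])
  also have "\<dots> = cont_calc (\<lambda>x. x * x) T"
  proof (rule cont_calc_cong)
    fix x
    assume "x \<in> real_spectrum T"
    then have "0 \<le> x"
      unfolding T_def by (rule spectrum_abs_op_nonneg[OF X])
    show "f x * f x * f x = x * x"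
    proof -
      have "f x * f x * f x = x powr (2/3 + 2/3 + 2/3)"
        using \<open>0 \<le> x\<close> by (simp only: f_def powr_add abs_of_nonneg)
      also have "\<dots> = x powr 2"
        by simp
      also have "\<dots> = x * x"
        using \<open>0 \<le> x\<close> by (cases "x = 0") (simp_all add: powr_numeral power2_eq_square)
      finally show ?thesis .
    qed
  qed
  also have "\<dots> = T o\<^sub>L T"
    by (subst cont_calc_mult) (auto simp: cont_calc_ident T intro!: continuous_intros)
  also have "\<dots> = X o\<^sub>L X"
    unfolding T_def by (rule abs_op_square[OF X])
  also have "\<dots> = (U o\<^sub>L U) o\<^sub>L (U o\<^sub>L U) o\<^sub>L (U o\<^sub>L U)"
    by (simp only: X_def blinfun_compose_assoc)
  finally have cube: "Q o\<^sub>L Q o\<^sub>L Q = (U o\<^sub>L U) o\<^sub>L (U o\<^sub>L U) o\<^sub>L (U o\<^sub>L U)" .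
  have "(X o\<^sub>L X) o\<^sub>L (U o\<^sub>L U) = (U o\<^sub>L U) o\<^sub>L (X o\<^sub>L X)"
    by (simp only: X_def blinfun_compose_assoc)
  then have "T o\<^sub>L (U o\<^sub>L U) = (U o\<^sub>L U) o\<^sub>L T"
    unfolding T_def abs_op_eq[OF X]
    by (rule cont_calc_commute[OF selfadjoint_square[OF X] continuous_sqrt])
  then have comm: "Q o\<^sub>L (U o\<^sub>L U) = (U o\<^sub>L U) o\<^sub>L Q"
    unfolding Q_def by (rule cont_calc_commute[OF T f])
  have "selfadjoint Q"
    unfolding Q_def by (rule selfadjoint_cont_calc[OF T f])
  then have "Q = U o\<^sub>L U"
    by (rule commuting_cube_inj[OF _ selfadjoint_square[OF U] comm cube])
  then show ?thesis
    by (simp only: op_powr)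
qed

section \<open>Resolvents and the function class\<close>

abbreviation resolvent :: "complex \<Rightarrow> 'h::complex_hilbert op \<Rightarrow> 'h op" where
  "resolvent z A \<equiv> op_inv (scaleC_op z id_blinfun - A)"

text \<open>For \<open>Im z < 0\<close> the operator \<open>\<i> (z - A)\<close> is coercive with constant \<open>- Im z\<close>.\<close>

lemma is_inverse_resolvent:
  assumes A: "selfadjoint A" and z: "Im z < 0"
  shows "is_inverse (scaleC_op z id_blinfun - A) (resolvent z A)"
proof -
  define X where "X = scaleC_op z id_blinfun - A"
  have X: "X \<in> bop"
    unfolding X_def using selfadjoint_bop[OF A] by (simp add: bop_diff bop_scaleC_op)
  obtain S where S: "is_inverse (scaleC_op \<i> X) S"
  proof -
    have "\<exists>S. is_inverse (scaleC_op \<i> X) S"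
    proof (rule coercive_invertible[where v = "- Im z"])
      show "- Im z * (norm x)\<^sup>2 \<le> inner (scaleC_op \<i> X x) x" for x
        using selfadjoint_shift_inner_i[OF A, of z x] by (simp add: X_def)
    qed (use z X in \<open>simp_all add: bop_scaleC_op\<close>)
    then show ?thesis
      using that by blast
  qed
  have "is_inverse X (scaleC_op \<i> S)"
  proof -
    have "S \<in> bop"
      using S by (simp add: is_inverse_def)
    then show ?thesis
      using S X by (simp add: is_inverse_def bop_scaleC_op scaleC_op_compose_right)
  qed
  then show ?thesis
    unfolding X_def[symmetric] by (simp add: op_inv_eq)
qed

lemma norm_resolvent_le:
  assumes A: "selfadjoint A" and z: "Im z < 0"
  shows "norm (resolvent z A) \<le> 1 / \<bar>Im z\<bar>"
proof (rule norm_blinfun_bound)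
  fix x
  have "(scaleC_op z id_blinfun - A) (resolvent z A x) = x"
    using is_inverse_resolvent[OF A z] unfolding is_inverse_def
    by (metis blinfun_apply_blinfun_compose blinfun_apply_id_blinfun)
  then have "\<bar>Im z\<bar> * norm (resolvent z A x) \<le> norm x"
    using selfadjoint_shift_lower_bound[OF A, of z "resolvent z A x"] by simp
  then show "norm (resolvent z A x) \<le> 1 / \<bar>Im z\<bar> * norm x"
    using z by (simp add: field_simps)
qed simp

lemma comb_fun_Nil [simp]: "comb_fun [] x = 0"
  and comb_fun_Cons [simp]:
    "comb_fun ((c, z, k) # ts) x = c * inverse (z - complex_of_real x) ^ k + comb_fun ts x"
  by (simp_all add: comb_fun_def)

lemma comb_fun_append: "comb_fun (ts @ us) x = comb_fun ts x + comb_fun us x"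
  by (simp add: comb_fun_def)

lemma comb_op_Nil [simp]: "comb_op [] H = 0"
  and comb_op_Cons [simp]:
    "comb_op ((c, z, k) # ts) H = scaleC_op c (op_pow (resolvent z H) k) + comb_op ts H"
  by (simp_all add: comb_op_def)

lemma admissible_Nil [simp]: "admissible []"
  and admissible_Cons [simp]: "admissible ((c, z, k) # ts) \<longleftrightarrow> Im z < 0 \<and> admissible ts"
  by (simp_all add: admissible_def)

lemma op_pow_Suc_right: "op_pow A (Suc k) = op_pow A k o\<^sub>L A"
proof (induction k)
  case (Suc k)
  then show ?case
    by (metis op_pow_Suc blinfun_compose_assoc)
qed simp

lemma op_pow_inverse:
  assumes "is_inverse A T"
  shows "op_pow A k o\<^sub>L op_pow T k = id_blinfun"
proof (induction k)
  case (Suc k)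
  have "op_pow A (Suc k) o\<^sub>L op_pow T (Suc k) = op_pow A k o\<^sub>L ((A o\<^sub>L T) o\<^sub>L op_pow T k)"
    unfolding op_pow_Suc_right[of A] by (simp add: blinfun_compose_assoc)
  then show ?case
    using Suc assms by (simp add: is_inverse_def)
qed simp

lemma bounded_below_op_pow: "bounded_below A \<Longrightarrow> bounded_below (op_pow A k)"
proof (induction k)
  case 0
  show ?case
    by (auto simp: bounded_below_def intro!: exI[of _ 1])
qed (simp add: bounded_below_compose)

text \<open>Clearing denominators: multiplying the function by \<open>D = \<Prod> (z - \<lambda>)\<^sup>k\<close> gives a polynomial
  \<open>N\<close>, and the same identity holds for the operators.\<close>

lemma comb_common_denominator:
  assumes H: "selfadjoint H" and "admissible ts"
  shows "\<exists>D N. (\<forall>x::real. poly N (of_real x) = poly D (of_real x) * comb_fun ts x) \<and>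
    cpoly_op N H = cpoly_op D H o\<^sub>L comb_op ts H \<and> bounded_below (cpoly_op D H)"
  using assms(2)
proof (induction ts)
  case Nil
  have "cpoly_op 1 H = id_blinfun"
    by (simp add: one_pCons cpoly_op_pCons selfadjoint_bop H)
  then show ?case
    by (intro exI[of _ 1] exI[of _ 0])
      (auto simp: bounded_below_def intro!: exI[of _ "1::real"])
next
  case (Cons t ts)
  obtain c z k where t: "t = (c, z, k)"
    by (cases t)
  have z: "Im z < 0" and ts: "admissible ts"
    using Cons.prems by (simp_all add: t)
  obtain D N where DN: "\<And>x::real. poly N (of_real x) = poly D (of_real x) * comb_fun ts x"
      "cpoly_op N H = cpoly_op D H o\<^sub>L comb_op ts H" "bounded_below (cpoly_op D H)"
    using Cons.IH[OF ts] by blast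
  note Hb = selfadjoint_bop[OF H]
  define X where "X = scaleC_op z id_blinfun - H"
  define L where "L = [:z, -1:]"
  have LH: "cpoly_op L H = X"
    unfolding L_def X_def
    by (rule blinfun_eqI) (simp add: cpoly_op_pCons[OF Hb] blinfun.bilinear_simps)
  have inv: "is_inverse X (resolvent z H)"
    unfolding X_def by (rule is_inverse_resolvent[OF H z])
  have DL: "cpoly_op (L ^ k * D) H o\<^sub>L Y = cpoly_op D H o\<^sub>L (op_pow X k o\<^sub>L Y)" for Y
    unfolding mult.commute[of "L ^ k"] cpoly_op_mult[OF Hb] cpoly_op_power[OF Hb] LH
    by (simp add: blinfun_compose_assoc)
  have D_bop: "cpoly_op (L ^ k * D) H \<in> bop"
  proof -
    have "cpoly_op p H \<in> bop" for p
      by (induction p) (simp_all add: cpoly_op_pCons Hb bop_add bop_compose bop_scaleC_op)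
    then show ?thesis .
  qed
  have "cpoly_op (L ^ k * N + smult c D) H = cpoly_op (L ^ k * D) H o\<^sub>L comb_op (t # ts) H"
  proof -
    have "cpoly_op (L ^ k * D) H o\<^sub>L scaleC_op c (op_pow (resolvent z H) k)
        = scaleC_op c (cpoly_op D H)"
      unfolding scaleC_op_compose_right[OF D_bop] unfolding DL op_pow_inverse[OF inv] by simp
    moreover have "cpoly_op (L ^ k * N) H = cpoly_op (L ^ k * D) H o\<^sub>L comb_op ts H"
      by (simp add: cpoly_op_mult[OF Hb] DN(2) blinfun_compose_assoc)
    ultimately show ?thesis
      by (simp add: t cpoly_op_add cpoly_op_smult compose_simps(3) add.commute)
  qed
  moreover have "poly (L ^ k * N + smult c D) (of_real x)
      = poly (L ^ k * D) (of_real x) * comb_fun (t # ts) x" for x :: real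
  proof -
    have "z - of_real x \<noteq> 0"
      using z by auto
    then show ?thesis
      by (simp add: t L_def DN(1) algebra_simps power_inverse)
  qed
  moreover have "bounded_below (cpoly_op (L ^ k * D) H)"
    unfolding cpoly_op_mult[OF Hb] cpoly_op_power[OF Hb] LH
    by (intro bounded_below_compose bounded_below_op_pow is_inverse_bounded_below[OF inv] DN(3))
  ultimately show ?case
    by blast
qed

text \<open>The numerator \<open>N\<close> vanishes on the real line, hence is zero, and \<open>D(H)\<close> is injective. So
  \<open>f(H)\<close> depends on the function only, not on the list that represents it.\<close>

lemma comb_op_eq_0:
  assumes H: "selfadjoint H" and "admissible ts" and zero: "\<And>x. comb_fun ts x = 0"
  shows "comb_op ts H = 0"
proof -
  obtain D N where DN: "\<And>x::real. poly N (of_real x) = poly D (of_real x) * comb_fun ts x"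
      "cpoly_op N H = cpoly_op D H o\<^sub>L comb_op ts H" "bounded_below (cpoly_op D H)"
    using comb_common_denominator[OF assms(1,2)] by blast
  have "range complex_of_real \<subseteq> {x. poly N x = 0}"
    using DN(1) zero by auto
  moreover have "infinite (range complex_of_real)"
    using infinite_UNIV_char_0[where 'a = real] by (subst finite_image_iff) (auto simp: inj_on_def)
  ultimately have "N = 0"
    using poly_roots_finite[of N] finite_subset by blast
  then have "cpoly_op D H (comb_op ts H x) = 0" for x
    using DN(2)[THEN arg_cong, of "\<lambda>T. blinfun_apply T x"] by simp
  moreover have "y = 0" if "cpoly_op D H y = 0" for y
    using DN(3) that unfolding bounded_below_def
    by (metis mult_le_0_iff norm_le_zero_iff norm_zero not_le)
  ultimately have "comb_op ts H x = 0" for x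
    by blast
  then show ?thesis
    by (intro blinfun_eqI) simp
qed

lemma fun_op_comb_fun:
  assumes H: "selfadjoint H" and "admissible ts"
  shows "fun_op (comb_fun ts) H = comb_op ts H"
  unfolding fun_op_def
proof (rule the_equality)
  show "\<exists>ts'. admissible ts' \<and> comb_fun ts = comb_fun ts' \<and> comb_op ts H = comb_op ts' H"
    using assms by blast
  fix T
  assume "\<exists>ts'. admissible ts' \<and> comb_fun ts = comb_fun ts' \<and> T = comb_op ts' H"
  then obtain us where us: "admissible us" "comb_fun us = comb_fun ts" "T = comb_op us H"
    by auto
  define neg :: "(complex \<times> complex \<times> nat) list" where "neg = map (\<lambda>(c, z, k). (- c, z, k)) ts"
  have neg: "comb_fun neg x = - comb_fun ts x" "admissible neg" "comb_op neg H = - comb_op ts H" for x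
  proof -
    show "comb_fun neg x = - comb_fun ts x"
      unfolding neg_def by (induction ts) auto
    show "admissible neg"
      using assms(2) unfolding neg_def by (induction ts) auto
    have "scaleC_op (- c) X = - scaleC_op c X" for c and X :: "'a op"
      by (rule blinfun_eqI) (simp add: blinfun.minus_left)
    then show "comb_op neg H = - comb_op ts H"
      unfolding neg_def by (induction ts) auto
  qed
  have "comb_op (us @ neg) H = 0"
  proof (rule comb_op_eq_0[OF H])
    show "admissible (us @ neg)"
      using us(1) neg(2) by (auto simp: admissible_def)
    show "comb_fun (us @ neg) x = 0" for x
      using us(2) neg(1)[of x] comb_fun_append[of us neg x] by simp
  qed
  then show "T = comb_op ts H"
    using us(3) neg(3) by (simp add: comb_op_def)
qed

text \<open>The derivative of \<open>(z - \<lambda>)\<^sup>-\<^sup>k\<close> is \<open>k (z - \<lambda>)\<^sup>-\<^sup>k\<^sup>-\<^sup>1\<close>, so the function class is closed under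
  differentiation.\<close>

definition deriv_terms ::
    "(complex \<times> complex \<times> nat) list \<Rightarrow> (complex \<times> complex \<times> nat) list" where
  "deriv_terms ts = map (\<lambda>(c, z, k). (c * of_nat k, z, Suc k)) ts"

lemma deriv_terms_Nil [simp]: "deriv_terms [] = []"
  and deriv_terms_Cons [simp]:
    "deriv_terms ((c, z, k) # ts) = (c * of_nat k, z, Suc k) # deriv_terms ts"
  by (simp_all add: deriv_terms_def)

lemma admissible_deriv_terms [simp]: "admissible (deriv_terms ts) \<longleftrightarrow> admissible ts"
  by (induction ts) auto

lemma has_vector_derivative_comb_fun:
  assumes "admissible ts"
  shows "(comb_fun ts has_vector_derivative comb_fun (deriv_terms ts) x) (at x)"
  using assms
proof (induction ts)
  case Nil
  have "comb_fun [] = (\<lambda>x. 0)"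
    by auto
  then show ?case
    by simp
next
  case (Cons t ts)
  obtain c z k where t: "t = (c, z, k)"
    by (cases t)
  have nz: "z - of_real x \<noteq> 0"
    using Cons.prems by (auto simp: t)
  have "((\<lambda>w. c * inverse (z - w) ^ k) has_field_derivative
      c * of_nat k * inverse (z - of_real x) ^ Suc k) (at (of_real x))"
  proof -
    have "((\<lambda>w. inverse (z - w)) has_field_derivative (inverse (z - of_real x))\<^sup>2)
        (at (of_real x))"
      using nz by (auto intro!: derivative_eq_intros simp: power2_eq_square)
    from DERIV_cmult[OF DERIV_power[OF this, of k], of c] show ?thesis
      by (cases k) (simp_all add: power2_eq_square mult_ac)
  qed
  then have "((\<lambda>y. c * inverse (z - of_real y) ^ k) has_vector_derivative
      c * of_nat k * inverse (z - of_real x) ^ Suc k) (at x)"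
    by (rule has_vector_derivative_real_field)
  from has_vector_derivative_add[OF this Cons.IH] show ?case
    using Cons.prems by (simp add: t)
qed

lemma second_derivative_comb_fun:
  assumes "admissible ts"
  shows "second_derivative (comb_fun ts) = comb_fun (deriv_terms (deriv_terms ts))"
proof
  fix x
  have "(\<lambda>y. vector_derivative (comb_fun ts) (at y)) = comb_fun (deriv_terms ts)"
    using has_vector_derivative_comb_fun[OF assms] by (auto intro: vector_derivative_at)
  then show "second_derivative (comb_fun ts) x = comb_fun (deriv_terms (deriv_terms ts)) x"
    using has_vector_derivative_comb_fun[of "deriv_terms ts" x] assms
    by (simp add: second_derivative_def vector_derivative_at)
qed


section \<open>Taylor expansion along \<open>a + t V\<close>\<close>

text \<open>The first three hypotheses are the geometric recursion \<open>R = u + u t V R\<close> applied to \<open>x\<close>, \<open>V x\<close>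
  and \<open>V\<^sup>2 x\<close>.\<close>

lemma scaleC_expansion_step:
  fixes x0 x1 x2 r0 r1 r2 r3 g :: "'h::complex_hilbert"
  assumes "r0 = u *\<^sub>C x0 + (u * t) *\<^sub>C r1" "r1 = u *\<^sub>C x1 + (u * t) *\<^sub>C r2"
    "r2 = u *\<^sub>C x2 + (u * t) *\<^sub>C r3"
    and "\<alpha>' = \<alpha> * u" "\<beta>' = (\<alpha>' + \<beta>) * u" "\<gamma>' = (\<beta>' + \<gamma>) * u"
  shows "\<alpha> *\<^sub>C r0 + (t * \<beta>) *\<^sub>C r1 + (t\<^sup>2 * \<gamma>) *\<^sub>C r2 + t ^ 3 *\<^sub>C g
    = \<alpha>' *\<^sub>C x0 + (t * \<beta>') *\<^sub>C x1 + (t\<^sup>2 * \<gamma>') *\<^sub>C x2 + t ^ 3 *\<^sub>C (\<gamma>' *\<^sub>C r3 + g)"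
  unfolding assms
  by (simp add: scaleC_add_left scaleC_add_right scaleC_scaleC algebra_simps power2_eq_square
      power3_eq_cube)

text \<open>The remainder \<open>G\<close> is a polynomial in the resolvent. It is kept in the commutant of a set
  containing \<open>V\<close>, so that it commutes with \<open>V\<close>.\<close>

lemma resolvent_power_expansion:
  fixes V :: "'h::complex_hilbert op" and a :: real
  assumes V: "selfadjoint V" and S: "S \<subseteq> bop" "V \<in> S" "V \<in> commutant S" and z: "Im z < 0"
  defines "u \<equiv> inverse (z - of_real a)"
  shows "\<exists>G M. (\<forall>t::real. G t \<in> commutant S \<and> norm (G t) \<le> M) \<and>
    (\<forall>t. op_pow (resolvent z (a *\<^sub>R id_blinfun + t *\<^sub>R V)) k =
      scaleC_op (u ^ k) id_blinfun + scaleC_op (of_real t * (of_nat k * u ^ Suc k)) V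
      + scaleC_op ((of_real t)\<^sup>2 * (of_nat (k * Suc k) / 2 * u ^ Suc (Suc k))) (V o\<^sub>L V)
      + scaleC_op (of_real t ^ 3) (V o\<^sub>L V o\<^sub>L V o\<^sub>L G t))"
proof (induction k)
  case 0
  show ?case
    by (intro exI[of _ "\<lambda>_. 0"] exI[of _ 0]) (simp add: S)
next
  case (Suc k)
  define R where "R = (\<lambda>t::real. resolvent z (a *\<^sub>R id_blinfun + t *\<^sub>R V))"
  obtain G M where G: "\<And>t. G t \<in> commutant S" "\<And>t. norm (G t) \<le> M"
    and expansion: "\<And>t. op_pow (R t) k =
      scaleC_op (u ^ k) id_blinfun + scaleC_op (of_real t * (of_nat k * u ^ Suc k)) V
      + scaleC_op ((of_real t)\<^sup>2 * (of_nat (k * Suc k) / 2 * u ^ Suc (Suc k))) (V o\<^sub>L V)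
      + scaleC_op (of_real t ^ 3) (V o\<^sub>L V o\<^sub>L V o\<^sub>L G t)"
    using Suc.IH unfolding R_def by blast
  have H: "selfadjoint (a *\<^sub>R id_blinfun + t *\<^sub>R V)" for t
    by (intro selfadjoint_add selfadjoint_scaleR selfadjoint_id V)
  have inv: "is_inverse (scaleC_op z id_blinfun - (a *\<^sub>R id_blinfun + t *\<^sub>R V)) (R t)" for t
    unfolding R_def by (rule is_inverse_resolvent[OF H z])
  have R_comm: "R t \<in> commutant S" for t
    using S by (intro commutant_inverse[OF _ _ inv] commutant_diff commutant_add commutant_scaleC
        commutant_scaleR) auto
  have RV: "R t (V x) = V (R t x)" for t x
    using commutant_comm[OF R_comm S(2)] by (metis blinfun_apply_blinfun_compose)
  note lin = bop_scaleC[OF commutant_bop[OF R_comm]] bop_scaleC[OF selfadjoint_bop[OF V]]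
  have nz: "z - of_real a \<noteq> 0"
    using z by auto
  have geo: "R t x = u *\<^sub>C x + (u * of_real t) *\<^sub>C V (R t x)" for t x
  proof -
    have "(scaleC_op z id_blinfun - (a *\<^sub>R id_blinfun + t *\<^sub>R V)) (R t x) = x"
      using inv[of t] unfolding is_inverse_def
      by (metis blinfun_apply_blinfun_compose blinfun_apply_id_blinfun)
    then have "(z - of_real a) *\<^sub>C R t x = x + of_real t *\<^sub>C V (R t x)"
      by (simp add: blinfun.bilinear_simps scaleC_diff_left scaleR_eq_scaleC algebra_simps)
    then have "u *\<^sub>C (z - of_real a) *\<^sub>C R t x = u *\<^sub>C (x + of_real t *\<^sub>C V (R t x))"
      by simp
    then show ?thesis
      using nz by (simp add: u_def scaleC_scaleC scaleC_add_right)
  qed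
  \<comment> \<open>The coefficient of \<open>t\<^sup>2 V\<^sup>2\<close> in the next power. The recursion for \<open>V\<^sup>2 R\<close> makes it
    also the coefficient of \<open>t\<^sup>3 V\<^sup>3 R\<close>, which is how it enters the new remainder.\<close>
  define c where "c = of_nat (Suc k * Suc (Suc k)) / 2 * u ^ Suc (Suc (Suc k))"
  define G' where "G' = (\<lambda>t. R t o\<^sub>L (scaleC_op c id_blinfun + G t))"
  have "G' t \<in> commutant S" for t
    unfolding G'_def
    by (intro commutant_compose commutant_add commutant_scaleC S R_comm G id_in_commutant)
  moreover have "norm (G' t) \<le> 1 / \<bar>Im z\<bar> * (cmod c + M)" for t
  proof -
    have "norm (scaleC_op c (id_blinfun :: 'h op)) \<le> cmod c * 1"
      by (rule order_trans[OF norm_scaleC_op_le]) (intro mult_left_mono norm_blinfun_id_le norm_ge_zero)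
    then have "norm (scaleC_op c id_blinfun + G t) \<le> cmod c + M"
      using G(2)[of t] by (intro norm_triangle_mono) simp_all
    then have "norm (R t) * norm (scaleC_op c id_blinfun + G t) \<le> 1 / \<bar>Im z\<bar> * (cmod c + M)"
      unfolding R_def by (intro mult_mono norm_resolvent_le H z) simp_all
    then show ?thesis
      unfolding G'_def by (rule order_trans[OF norm_blinfun_compose])
  qed
  moreover have "op_pow (R t) (Suc k) =
      scaleC_op (u ^ Suc k) id_blinfun + scaleC_op (of_real t * (of_nat (Suc k) * u ^ Suc (Suc k))) V
      + scaleC_op ((of_real t)\<^sup>2 * c) (V o\<^sub>L V)
      + scaleC_op (of_real t ^ 3) (V o\<^sub>L V o\<^sub>L V o\<^sub>L G' t)" for t
  proof (rule blinfun_eqI)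
    fix x
    have "op_pow (R t) (Suc k) x = u ^ k *\<^sub>C R t x
        + (of_real t * (of_nat k * u ^ Suc k)) *\<^sub>C V (R t x)
        + ((of_real t)\<^sup>2 * (of_nat (k * Suc k) / 2 * u ^ Suc (Suc k))) *\<^sub>C V (V (R t x))
        + of_real t ^ 3 *\<^sub>C V (V (V (R t (G t x))))"
      by (simp add: expansion blinfun.add_left blinfun.add_right lin RV)
    also have "\<dots> = u ^ Suc k *\<^sub>C x + (of_real t * (of_nat (Suc k) * u ^ Suc (Suc k))) *\<^sub>C V x
        + ((of_real t)\<^sup>2 * c) *\<^sub>C V (V x)
        + of_real t ^ 3 *\<^sub>C (c *\<^sub>C V (V (V (R t x))) + V (V (V (R t (G t x)))))"
    proof (rule scaleC_expansion_step[where u = u])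
      show "R t x = u *\<^sub>C x + (u * of_real t) *\<^sub>C V (R t x)"
        by (rule geo)
      show "V (R t x) = u *\<^sub>C V x + (u * of_real t) *\<^sub>C V (V (R t x))"
        using geo[of t "V x"] by (simp add: RV)
      show "V (V (R t x)) = u *\<^sub>C V (V x) + (u * of_real t) *\<^sub>C V (V (V (R t x)))"
        using geo[of t "V (V x)"] by (simp add: RV)
    qed (simp_all add: c_def field_simps)
    finally show "op_pow (R t) (Suc k) x = (scaleC_op (u ^ Suc k) id_blinfun
      + scaleC_op (of_real t * (of_nat (Suc k) * u ^ Suc (Suc k))) V
      + scaleC_op ((of_real t)\<^sup>2 * c) (V o\<^sub>L V)
      + scaleC_op (of_real t ^ 3) (V o\<^sub>L V o\<^sub>L V o\<^sub>L G' t)) x"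
      by (simp add: G'_def blinfun.add_left blinfun.add_right lin del: op_pow_Suc power_Suc)
  qed
  ultimately show ?case
    unfolding R_def c_def by blast
qed

lemma comb_op_expansion:
  fixes V :: "'h::complex_hilbert op" and a :: real
  assumes V: "selfadjoint V" and S: "S \<subseteq> bop" "V \<in> S" "V \<in> commutant S" and "admissible ts"
  shows "\<exists>G M. (\<forall>t::real. G t \<in> commutant S \<and> norm (G t) \<le> M) \<and>
    (\<forall>t. comb_op ts (a *\<^sub>R id_blinfun + t *\<^sub>R V) =
      scaleC_op (comb_fun ts a) id_blinfun
      + scaleC_op (of_real t * comb_fun (deriv_terms ts) a) V
      + scaleC_op ((of_real t)\<^sup>2 * (comb_fun (deriv_terms (deriv_terms ts)) a / 2)) (V o\<^sub>L V)
      + scaleC_op (of_real t ^ 3) (V o\<^sub>L V o\<^sub>L V o\<^sub>L G t))"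
  using assms(5)
proof (induction ts)
  case Nil
  show ?case
    by (intro exI[of _ "\<lambda>_. 0"] exI[of _ 0]) (simp add: S)
next
  case (Cons s ts)
  obtain c z k where s: "s = (c, z, k)"
    by (cases s)
  have z: "Im z < 0" and ts: "admissible ts"
    using Cons.prems by (simp_all add: s)
  obtain G M where G: "\<And>t. G t \<in> commutant S" "\<And>t. norm (G t) \<le> M"
    and expG: "\<And>t. comb_op ts (a *\<^sub>R id_blinfun + t *\<^sub>R V) =
      scaleC_op (comb_fun ts a) id_blinfun
      + scaleC_op (of_real t * comb_fun (deriv_terms ts) a) V
      + scaleC_op ((of_real t)\<^sup>2 * (comb_fun (deriv_terms (deriv_terms ts)) a / 2)) (V o\<^sub>L V)
      + scaleC_op (of_real t ^ 3) (V o\<^sub>L V o\<^sub>L V o\<^sub>L G t)"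
    using Cons.IH[OF ts] by blast
  define u where "u = inverse (z - of_real a)"
  obtain K L where K: "\<And>t. K t \<in> commutant S" "\<And>t. norm (K t) \<le> L"
    and expK: "\<And>t. op_pow (resolvent z (a *\<^sub>R id_blinfun + t *\<^sub>R V)) k =
      scaleC_op (u ^ k) id_blinfun + scaleC_op (of_real t * (of_nat k * u ^ Suc k)) V
      + scaleC_op ((of_real t)\<^sup>2 * (of_nat (k * Suc k) / 2 * u ^ Suc (Suc k))) (V o\<^sub>L V)
      + scaleC_op (of_real t ^ 3) (V o\<^sub>L V o\<^sub>L V o\<^sub>L K t)"
    using resolvent_power_expansion[OF V S z, of a k] unfolding u_def by blast
  have "norm (scaleC_op c (K t) + G t) \<le> cmod c * L + M" for t
    by (intro norm_triangle_mono G order_trans[OF norm_scaleC_op_le] mult_left_mono K) simp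
  moreover have "scaleC_op c (K t) + G t \<in> commutant S" for t
    by (intro commutant_add commutant_scaleC S G K)
  moreover have "comb_op (s # ts) (a *\<^sub>R id_blinfun + t *\<^sub>R V) =
      scaleC_op (comb_fun (s # ts) a) id_blinfun
      + scaleC_op (of_real t * comb_fun (deriv_terms (s # ts)) a) V
      + scaleC_op ((of_real t)\<^sup>2 * (comb_fun (deriv_terms (deriv_terms (s # ts))) a / 2)) (V o\<^sub>L V)
      + scaleC_op (of_real t ^ 3) (V o\<^sub>L V o\<^sub>L V o\<^sub>L (scaleC_op c (K t) + G t))" for t
    unfolding s comb_op_Cons expG expK deriv_terms_Cons comb_fun_Cons u_def[symmetric]
    by (rule blinfun_eqI)
      (simp add: blinfun.add_left blinfun.add_right scaleC_add_left scaleC_add_right scaleC_scaleC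
        bop_scaleC[OF selfadjoint_bop[OF V]] algebra_simps add_divide_distrib)
  ultimately show ?case
    by (intro exI[of _ "\<lambda>t. scaleC_op c (K t) + G t"] exI[of _ "cmod c * L + M"]) blast
qed

section \<open>The trace on third-order terms\<close>

lemma ideal_power_half_iff:
  "selfadjoint X \<Longrightarrow> X \<in> ideal_power B I (1/2) \<longleftrightarrow> X \<in> B \<and> X o\<^sub>L X \<in> I"
  by (simp add: ideal_power_def abs_op_powr_2)

lemma cube_in_ideal_power:
  assumes "selfadjoint U" "U o\<^sub>L U o\<^sub>L U \<in> B" "U o\<^sub>L U \<in> I"
  shows "U o\<^sub>L U o\<^sub>L U \<in> ideal_power B I (3/2)"
  using assms by (simp add: ideal_power_def abs_op_cube_powr)

lemma
  fixes G :: "'h::complex_hilbert op"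
  assumes "G \<in> bop"
  shows selfadjoint_real_part: "selfadjoint ((1/2) *\<^sub>R (G + adj G))"
    and selfadjoint_imaginary_part: "selfadjoint (scaleC_op (- \<i> / 2) (G - adj G))"
proof -
  have G: "inner (G x) y = inner x (adj G y)" for x y
    using cinner_adj[OF assms, of x y] by (simp add: inner_eq_Re_cinner)
  have G': "inner (adj G x) y = inner x (G y)" for x y
    using G[of y x] by (simp add: inner_commute)
  note bop = assms adj_in_bop[OF assms]
  show "selfadjoint ((1/2) *\<^sub>R (G + adj G))"
    using bop
    by (simp add: selfadjoint_def bop_add bop_scaleR blinfun.bilinear_simps inner_add_left
        inner_add_right G G')
  have "inner ((- \<i> / 2) *\<^sub>C (G x - adj G x)) y = inner x ((- \<i> / 2) *\<^sub>C (G y - adj G y))"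
    for x y
  proof -
    have "inner ((- \<i> / 2) *\<^sub>C (G x - adj G x)) y = inner (G x - adj G x) ((\<i> / 2) *\<^sub>C y)"
      unfolding inner_eq_Re_cinner cinner_scaleC_left cinner_scaleC_right by simp
    also have "\<dots> = inner x ((\<i> / 2) *\<^sub>C (adj G y - G y))"
      using bop by (simp add: inner_diff_left inner_diff_right G G' scaleC_diff_right bop_scaleC)
    also have "(\<i> / 2) *\<^sub>C (adj G y - G y) = (- \<i> / 2) *\<^sub>C (G y - adj G y)"
      by (simp add: scaleC_diff_right)
    finally show ?thesis .
  qed
  then show "selfadjoint (scaleC_op (- \<i> / 2) (G - adj G))"
    using bop by (simp add: selfadjoint_def bop_diff bop_scaleC_op blinfun.diff_left)
qed

lemma real_imaginary_decomposition:
  "G = (1/2) *\<^sub>R (G + adj G) + scaleC_op \<i> (scaleC_op (- \<i> / 2) (G - adj G))"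
  by (rule blinfun_eqI)
    (simp add: blinfun.bilinear_simps scaleC_simps flip: scaleC_add_left)

text \<open>The trace kills cubes of self-adjoint elements of \<open>I\<^sup>1\<^sup>/\<^sup>2\<close>, because \<open>|U\<^sup>3|\<^sup>2\<^sup>/\<^sup>3 = U\<^sup>2 \<in> I\<close>. The
  identity \<open>6 S = (S + 1)\<^sup>3 + (S - 1)\<^sup>3 - 2 S\<^sup>3\<close>, multiplied by \<open>V\<^sup>3\<close>, writes \<open>V\<^sup>3 S\<close> as a
  combination of the cubes of \<open>V (S + 1)\<close>, \<open>V (S - 1)\<close> and \<open>V S\<close>. This covers the real and the
  imaginary part of any \<open>G\<close> that commutes with \<open>V\<close>.\<close>

lemma trace_third_order_zero:
  fixes B I :: "'h::complex_hilbert op set"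
  assumes B: "von_neumann_algebra B" and I: "two_sided_ideal B I"
    and I2: "two_sided_ideal B (ideal_power B I (1/2))"
    and \<tau>: "trace_on B I \<tau>" and zero: "\<tau> ` ideal_power B I (3/2) = {0}"
    and V: "V \<in> ideal_power B I (1/2)" "selfadjoint V"
    and G: "G \<in> B" "V o\<^sub>L G = G o\<^sub>L V"
  shows "V o\<^sub>L V o\<^sub>L V o\<^sub>L G \<in> I \<and> \<tau> (V o\<^sub>L V o\<^sub>L V o\<^sub>L G) = 0"
proof -
  define C where "C = commutant (commutant B)"
  have CB: "C = B" and Bbop: "B \<subseteq> bop" and Badj: "\<And>A. A \<in> B \<Longrightarrow> adj A \<in> B"
    using B by (simp_all add: von_neumann_algebra_def C_def)
  have S: "commutant B \<subseteq> bop"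
    using commutant_bop by blast
  note B_closed = commutant_add[OF S, folded C_def, unfolded CB]
    commutant_diff[OF S, folded C_def, unfolded CB]
    commutant_scaleC[OF S, folded C_def, unfolded CB]
    commutant_scaleR[OF S, folded C_def, unfolded CB]
    commutant_compose[OF S, folded C_def, unfolded CB]
    id_in_commutant[of "commutant B", folded C_def, unfolded CB]
  have VB: "V \<in> B"
    using V(1) by (simp add: ideal_power_def)
  have Vbop: "V \<in> bop"
    using VB Bbop by blast
  have I_left: "X \<in> B \<Longrightarrow> Y \<in> I \<Longrightarrow> X o\<^sub>L Y \<in> I" and I_right: "X \<in> B \<Longrightarrow> Y \<in> I \<Longrightarrow> Y o\<^sub>L X \<in> I"
    and I_add: "X \<in> I \<Longrightarrow> Y \<in> I \<Longrightarrow> X + Y \<in> I" and I_scaleC: "X \<in> I \<Longrightarrow> scaleC_op c X \<in> I"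
    for X Y c
    using I by (auto simp: two_sided_ideal_def)
  have \<tau>_add: "X \<in> I \<Longrightarrow> Y \<in> I \<Longrightarrow> \<tau> (X + Y) = \<tau> X + \<tau> Y"
    and \<tau>_scaleC: "X \<in> I \<Longrightarrow> \<tau> (scaleC_op c X) = c * \<tau> X" for X Y c
    using \<tau> by (auto simp: trace_on_def)
  have cube: "U o\<^sub>L U o\<^sub>L U \<in> I \<and> \<tau> (U o\<^sub>L U o\<^sub>L U) = 0"
    if "U = V o\<^sub>L X" "selfadjoint X" "X \<in> B" "V o\<^sub>L X = X o\<^sub>L V" for U X
  proof -
    have U: "selfadjoint U"
      unfolding that(1) using V(2) that(2,4) by (rule selfadjoint_compose)
    have "U \<in> ideal_power B I (1/2)"
      using I2 V(1) that(1,3) by (auto simp: two_sided_ideal_def)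
    then have "U \<in> B" "U o\<^sub>L U \<in> I"
      using ideal_power_half_iff[OF U] by auto
    moreover from this have U3: "U o\<^sub>L U o\<^sub>L U \<in> I"
      by (rule I_right)
    moreover have "I \<subseteq> B"
      using I by (simp add: two_sided_ideal_def)
    ultimately have "U o\<^sub>L U o\<^sub>L U \<in> ideal_power B I (3/2)"
      using U by (intro cube_in_ideal_power) auto
    then show ?thesis
      using zero U3 by blast
  qed
  have sa_case: "V o\<^sub>L V o\<^sub>L V o\<^sub>L X \<in> I \<and> \<tau> (V o\<^sub>L V o\<^sub>L V o\<^sub>L X) = 0"
    if X: "selfadjoint X" "X \<in> B" "V o\<^sub>L X = X o\<^sub>L V" for X
  proof -
    define W where "W = (\<lambda>Y. (V o\<^sub>L Y) o\<^sub>L (V o\<^sub>L Y) o\<^sub>L (V o\<^sub>L Y))"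
    have W: "W Y \<in> I" "\<tau> (W Y) = 0"
      if "Y \<in> {X + id_blinfun, X - id_blinfun, X}" for Y
    proof -
      have "selfadjoint Y" "Y \<in> B" "V o\<^sub>L Y = Y o\<^sub>L V"
        using that X by (auto intro: selfadjoint_add selfadjoint_diff B_closed
            simp: compose_simps)
      then show "W Y \<in> I" "\<tau> (W Y) = 0"
        unfolding W_def using cube by blast+
    qed
    have "V o\<^sub>L V o\<^sub>L V o\<^sub>L X = scaleC_op (1/6) (W (X + id_blinfun))
        + (scaleC_op (1/6) (W (X - id_blinfun)) + scaleC_op (-1/3) (W X))"
    proof (rule blinfun_eqI)
      fix x
      have c: "X (V y) = V (X y)" for y
        using X(3)[THEN arg_cong, of "\<lambda>T. blinfun_apply T y"] by simp
      have six: "6 *\<^sub>R y = y + y + y + y + y + y" for y :: 'h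
        using scaleR_add_left[of 2 4 y] scaleR_add_left[of 2 2 y] by (simp add: scaleR_2)
      define y where "y = V (V (V (X x)))"
      have "6 *\<^sub>R y = W (X + id_blinfun) x + W (X - id_blinfun) x - 2 *\<^sub>R W X x"
        unfolding six by (simp add: y_def W_def blinfun.bilinear_simps c scaleR_2)
      then have "y = (1/6) *\<^sub>R (W (X + id_blinfun) x + W (X - id_blinfun) x - 2 *\<^sub>R W X x)"
        by (metis scaleR_scaleR scaleR_one divide_self_if times_divide_eq_left mult_1 zero_neq_numeral)
      also have "\<dots> = (1/6) *\<^sub>R W (X + id_blinfun) x
          + ((1/6) *\<^sub>R W (X - id_blinfun) x + (-1/3) *\<^sub>R W X x)"
        by (simp add: scaleR_add_right scaleR_diff_right)
      finally show "(V o\<^sub>L V o\<^sub>L V o\<^sub>L X) x = (scaleC_op (1/6) (W (X + id_blinfun))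
          + (scaleC_op (1/6) (W (X - id_blinfun)) + scaleC_op (-1/3) (W X))) x"
        by (simp add: y_def blinfun.add_left scaleR_eq_scaleC)
    qed
    then show ?thesis
      by (simp add: W I_add I_scaleC \<tau>_add \<tau>_scaleC)
  qed
  have Gbop: "G \<in> bop" and adjG: "adj G \<in> B"
    using G Bbop Badj by auto
  have "V o\<^sub>L adj G = adj G o\<^sub>L V"
  proof (rule blinfun_eqI)
    fix y
    have "inner x (V (adj G y)) = inner x (adj G (V y))" for x
    proof -
      have adj: "inner (G x) y = inner x (adj G y)" for x y
        using cinner_adj[OF Gbop, of x y] by (simp add: inner_eq_Re_cinner)
      have "inner x (V (adj G y)) = inner (G (V x)) y"
        by (simp add: adj selfadjoint_inner[OF V(2), symmetric])
      also have "\<dots> = inner (V (G x)) y"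
        using G(2)[THEN arg_cong, of "\<lambda>T. blinfun_apply T x"] by simp
      also have "\<dots> = inner x (adj G (V y))"
        by (simp add: adj selfadjoint_inner[OF V(2)])
      finally show ?thesis .
    qed
    then show "(V o\<^sub>L adj G) y = (adj G o\<^sub>L V) y"
      using vector_eq_ldot[of "V (adj G y)" "adj G (V y)"] by (simp add: inner_commute)
  qed
  note VG = this G(2)
  define X where "X = (1/2) *\<^sub>R (G + adj G)"
  define Y where "Y = scaleC_op (- \<i> / 2) (G - adj G)"
  have X: "V o\<^sub>L V o\<^sub>L V o\<^sub>L X \<in> I \<and> \<tau> (V o\<^sub>L V o\<^sub>L V o\<^sub>L X) = 0"
    unfolding X_def using G adjG Gbop
    by (intro sa_case selfadjoint_real_part B_closed) (auto simp: compose_simps VG)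
  have Y: "V o\<^sub>L V o\<^sub>L V o\<^sub>L Y \<in> I \<and> \<tau> (V o\<^sub>L V o\<^sub>L V o\<^sub>L Y) = 0"
    unfolding Y_def using G adjG Gbop
    by (intro sa_case selfadjoint_imaginary_part B_closed)
      (auto simp: compose_simps VG scaleC_op_compose_right[OF Vbop])
  have "V o\<^sub>L V o\<^sub>L V o\<^sub>L G = (V o\<^sub>L V o\<^sub>L V o\<^sub>L X) + scaleC_op \<i> (V o\<^sub>L V o\<^sub>L V o\<^sub>L Y)"
    by (subst real_imaginary_decomposition[of G], fold X_def Y_def)
      (simp add: compose_simps scaleC_op_compose_right[OF Vbop])
  then show ?thesis
    using X Y by (simp add: I_add I_scaleC \<tau>_add \<tau>_scaleC)
qed

section \<open>Multiples of a Dirac measure\<close>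

text \<open>Almost everywhere for a multiple of \<open>\<delta>\<^sub>a\<close>, the function \<open>g\<close> equals the constant \<open>g(a)\<close>.\<close>

lemma
  fixes g :: "real \<Rightarrow> complex" and r a :: real
  assumes "continuous_on UNIV g" "r \<ge> 0"
  defines "\<nu> \<equiv> scale_measure (ennreal r) (return borel a)"
  shows integrable_scaled_dirac: "integrable \<nu> g"
    and integral_scaled_dirac: "(\<integral>x. g x \<partial>\<nu>) = of_real r * g a"
proof -
  have sets: "sets \<nu> = sets borel"
    by (simp add: \<nu>_def)
  have space: "space \<nu> = UNIV"
    by (simp add: \<nu>_def space_scale_measure)
  have total: "emeasure \<nu> (space \<nu>) = ennreal r"
    by (simp add: \<nu>_def space_scale_measure)
  have g: "g \<in> borel_measurable \<nu>"
    using borel_measurable_continuous_onI[OF assms(1)] sets measurable_cong_sets by blast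
  have "emeasure \<nu> (UNIV - {a}) = 0"
    by (simp add: \<nu>_def indicator_def)
  then have ae: "AE x in \<nu>. g x = g a"
    by (intro AE_I[where N = "UNIV - {a}"]) (auto simp: sets)
  interpret finite_measure \<nu>
    by (rule finite_measureI) (simp add: total)
  show "integrable \<nu> g"
    using integrable_cong_AE[OF g _ ae] by simp
  have "(\<integral>x. g x \<partial>\<nu>) = (\<integral>x. g a \<partial>\<nu>)"
    by (rule integral_cong_AE[OF g _ ae]) simp
  then show "(\<integral>x. g x \<partial>\<nu>) = of_real r * g a"
    using assms(2) by (simp add: measure_def total scaleR_conv_of_real)
qed

text \<open>By additivity, each partition sum is the mass of the whole space.\<close>

lemma total_variation_le: "total_variation \<nu> \<le> emeasure \<nu> (space \<nu>)"
  unfolding total_variation_def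
proof (rule SUP_least)
  fix P
  assume "P \<in> {P. finite P \<and> P \<subseteq> sets \<nu> \<and> disjoint P \<and> \<Union>P = space \<nu>}"
  then have P: "finite P" "P \<subseteq> sets \<nu>" "disjoint P" "\<Union>P = space \<nu>"
    by auto
  have "disjoint_family_on (\<lambda>E. E) P"
    using P(3) by (auto simp: disjoint_family_on_def disjoint_def)
  then have "(\<Sum>E\<in>P. emeasure \<nu> E) = emeasure \<nu> (\<Union>E\<in>P. E)"
    using P(1,2) by (intro sum_emeasure) auto
  then show "(\<Sum>E\<in>P. emeasure \<nu> E) \<le> emeasure \<nu> (space \<nu>)"
    using P(4) by simp
qed


section \<open>The trace formula\<close>

lemma has_vector_derivative_second_order:
  fixes F :: "real \<Rightarrow> 'a::real_normed_vector"
  assumes "\<And>t. F t = A + t *\<^sub>R D + t\<^sup>2 *\<^sub>R E t" and "\<And>t. \<bar>t\<bar> \<le> 1 \<Longrightarrow> norm (E t) \<le> K"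
  shows "(F has_vector_derivative D) (at 0)"
  unfolding has_vector_derivative_def has_derivative_at
proof (intro conjI)
  show "bounded_linear (\<lambda>h. h *\<^sub>R D)"
    by (rule bounded_linear_scaleR_left)
  show "(\<lambda>h. norm (F (0 + h) - F 0 - h *\<^sub>R D) / norm h) \<midarrow>0\<rightarrow> 0"
  proof (rule Lim_null_comparison)
    show "\<forall>\<^sub>F h in at 0. norm (norm (F (0 + h) - F 0 - h *\<^sub>R D) / norm h) \<le> \<bar>h\<bar> * K"
      unfolding eventually_at
    proof (intro exI[of _ 1] conjI ballI impI)
      fix h :: real
      assume h: "h \<noteq> 0 \<and> dist h 0 < 1"
      have "norm (F (0 + h) - F 0 - h *\<^sub>R D) / norm h = \<bar>h\<bar> * norm (E h)"
        using h by (cases "h > 0") (simp_all add: assms(1) power2_eq_square)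
      then show "norm (norm (F (0 + h) - F 0 - h *\<^sub>R D) / norm h) \<le> \<bar>h\<bar> * K"
        using h assms(2)[of h] by (simp add: mult_left_mono)
    qed simp
    show "(\<lambda>h. \<bar>h\<bar> * K) \<midarrow>0\<rightarrow> 0"
      by (auto intro!: tendsto_eq_intros)
  qed
qed

lemma positive_square: "selfadjoint X \<Longrightarrow> op_le 0 (X o\<^sub>L X)"
  by (auto simp: op_le_def positive_op_def bop_compose selfadjoint_def cinner_self
      cinner_adjoint(2)[of X X] simp flip: of_real_power)

theorem proposition5p12:
  fixes B I :: "'h::complex_hilbert op set"
    and N N2 :: "'h op \<Rightarrow> real"
    and \<tau> :: "'h op \<Rightarrow> complex"
    and a :: real
    and H0 V :: "'h op"
    and \<nu> :: "real measure"
  assumes "factor B" and "sigma_finite_vna B" and "semifinite_vna B"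
    and "normed_ideal B I N"
    and "trace_on B I \<tau>" and "positive_trace I \<tau>" and "norm_bounded_trace I N \<tau>"
    and "normed_ideal B (ideal_power B I (1/2)) N2"
    and "\<forall>X \<in> ideal_power B I (1/2). \<forall>Y \<in> ideal_power B I (1/2). N (X o\<^sub>L Y) \<le> N2 X * N2 Y"
    and "\<tau> ` ideal_power B I (3/2) = {0}"
    and "H0 = a *\<^sub>R id_blinfun"
    and "V \<in> ideal_power B I (1/2)" and "adj V = V"
    and "\<nu> = scale_measure (ennreal (1/2 * Re (\<tau> (V o\<^sub>L V)))) (return borel a :: real measure)"
  shows "V o\<^sub>L V \<in> I \<and> \<tau> (V o\<^sub>L V) \<in> \<real>\<^sub>\<ge>\<^sub>0 \<and>
    (\<forall>f \<in> resolvent_span.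
       (\<lambda>t::real. fun_op f (H0 + t *\<^sub>R V)) differentiable (at 0) \<and>
       fun_op f (H0 + V) - fun_op f H0
         - vector_derivative (\<lambda>t. fun_op f (H0 + t *\<^sub>R V)) (at 0) \<in> I \<and>
       integrable \<nu> (second_derivative f) \<and>
       \<tau> (fun_op f (H0 + V) - fun_op f H0
            - vector_derivative (\<lambda>t. fun_op f (H0 + t *\<^sub>R V)) (at 0))
         = (\<integral>x. second_derivative f x \<partial>\<nu>)) \<and>
    abs_op V o\<^sub>L abs_op V \<in> I \<and> \<tau> (abs_op V o\<^sub>L abs_op V) \<in> \<real>\<^sub>\<ge>\<^sub>0 \<and>
    total_variation \<nu> \<le> ennreal (1/2 * Re (\<tau> (abs_op V o\<^sub>L abs_op V)))"
proof -
  have vna: "von_neumann_algebra B"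
    using assms(1) by (simp add: factor_def)
  have I: "two_sided_ideal B I" and I2: "two_sided_ideal B (ideal_power B I (1/2))"
    using assms(4,8) by (simp_all add: normed_ideal_def)
  have VB: "V \<in> B"
    using assms(12) by (simp add: ideal_power_def)
  have Bbop: "B \<subseteq> bop" and bicommutant: "commutant (commutant B) = B"
    using vna by (auto simp: von_neumann_algebra_def)
  have V: "selfadjoint V"
    using VB Bbop assms(13) by (intro selfadjointI) auto
  have VV: "V o\<^sub>L V \<in> I"
    using assms(12) ideal_power_half_iff[OF V] by blast
  have pos: "\<tau> (V o\<^sub>L V) \<in> \<real>\<^sub>\<ge>\<^sub>0"
    using assms(6) VV positive_square[OF V] by (simp add: positive_trace_def)
  define r where "r = 1/2 * Re (\<tau> (V o\<^sub>L V))"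
  have r: "r \<ge> 0" "of_real r = \<tau> (V o\<^sub>L V) / 2"
    using pos by (auto simp: r_def complex_nonneg_Reals_iff complex_eq_iff)
  have \<nu>: "\<nu> = scale_measure (ennreal r) (return borel a)"
    by (simp add: assms(14) r_def)
  \<comment> \<open>By the bicommutant property, the commutant of \<open>S\<close> consists of the elements of \<open>B\<close> that
    commute with \<open>V\<close>.\<close>
  define S where "S = insert V (commutant B)"
  have S: "S \<subseteq> bop" "V \<in> S" "V \<in> commutant S"
    using VB Bbop by (auto simp: S_def commutant_def)
  have commutant_S: "G \<in> B" "V o\<^sub>L G = G o\<^sub>L V" if "G \<in> commutant S" for G
  proof -
    have "G \<in> commutant (commutant B)"
      using that by (simp add: S_def commutant_def)
    then show "G \<in> B"
      by (simp add: bicommutant)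
    show "V o\<^sub>L G = G o\<^sub>L V"
      using commutant_comm[OF that S(2)] by simp
  qed
  have "(\<lambda>t::real. fun_op f (H0 + t *\<^sub>R V)) differentiable (at 0) \<and>
       fun_op f (H0 + V) - fun_op f H0
         - vector_derivative (\<lambda>t. fun_op f (H0 + t *\<^sub>R V)) (at 0) \<in> I \<and>
       integrable \<nu> (second_derivative f) \<and>
       \<tau> (fun_op f (H0 + V) - fun_op f H0
            - vector_derivative (\<lambda>t. fun_op f (H0 + t *\<^sub>R V)) (at 0))
         = (\<integral>x. second_derivative f x \<partial>\<nu>)"
    if "f \<in> resolvent_span" for f
  proof -
    obtain ts where ts: "admissible ts" and f: "f = comb_fun ts"
      using \<open>f \<in> resolvent_span\<close> by (auto simp: resolvent_span_def)
    define f2 where "f2 = comb_fun (deriv_terms (deriv_terms ts))"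
    define D where "D = scaleC_op (comb_fun (deriv_terms ts) a) V"
    obtain G M where G: "\<And>t. G t \<in> commutant S" "\<And>t. norm (G t) \<le> M"
      and expansion: "\<And>t. comb_op ts (a *\<^sub>R id_blinfun + t *\<^sub>R V) =
        scaleC_op (comb_fun ts a) id_blinfun
        + scaleC_op (of_real t * comb_fun (deriv_terms ts) a) V
        + scaleC_op ((of_real t)\<^sup>2 * (comb_fun (deriv_terms (deriv_terms ts)) a / 2)) (V o\<^sub>L V)
        + scaleC_op (of_real t ^ 3) (V o\<^sub>L V o\<^sub>L V o\<^sub>L G t)"
      using comb_op_expansion[OF V S ts, of a] by blast
    define Z where "Z = (\<lambda>t. V o\<^sub>L V o\<^sub>L V o\<^sub>L G t)"
    define E where "E = (\<lambda>t. scaleC_op (f2 a / 2) (V o\<^sub>L V) + t *\<^sub>R Z t)"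
    have fun_op: "fun_op f (H0 + t *\<^sub>R V)
        = scaleC_op (f a) id_blinfun + t *\<^sub>R D + t\<^sup>2 *\<^sub>R E t" for t
    proof -
      have "selfadjoint (a *\<^sub>R id_blinfun + t *\<^sub>R V)"
        by (intro selfadjoint_add selfadjoint_scaleR selfadjoint_id V)
      then have "fun_op f (H0 + t *\<^sub>R V) = comb_op ts (a *\<^sub>R id_blinfun + t *\<^sub>R V)"
        unfolding f assms(11) by (rule fun_op_comb_fun[OF _ ts])
      then show ?thesis
        unfolding expansion
        by (simp add: f f2_def D_def E_def Z_def scaleR_op_eq scaleC_op_add_right
            power2_eq_square power3_eq_cube add.assoc mult.assoc)
    qed
    have ZI: "Z t \<in> I" "\<tau> (Z t) = 0" for t
      using trace_third_order_zero[OF vna I I2 assms(5,10,12) V commutant_S[OF G(1)]]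
      by (auto simp: Z_def)
    define K where "K = norm (scaleC_op (f2 a / 2) (V o\<^sub>L V)) + norm (V o\<^sub>L V o\<^sub>L V) * M"
    have "norm (E t) \<le> K" if "\<bar>t\<bar> \<le> 1" for t
    proof -
      have "norm (Z t) \<le> norm (V o\<^sub>L V o\<^sub>L V) * norm (G t)"
        unfolding Z_def by (rule norm_blinfun_compose)
      also have "\<dots> \<le> norm (V o\<^sub>L V o\<^sub>L V) * M"
        by (intro mult_left_mono G) simp
      finally have "\<bar>t\<bar> * norm (Z t) \<le> norm (V o\<^sub>L V o\<^sub>L V) * M"
        using that mult_left_le_one_le[of "norm (Z t)" "\<bar>t\<bar>"] by simp
      then show ?thesis
        unfolding E_def K_def by (intro norm_triangle_mono) simp_all
    qed
    with fun_op have deriv: "((\<lambda>t. fun_op f (H0 + t *\<^sub>R V)) has_vector_derivative D) (at 0)"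
      by (rule has_vector_derivative_second_order)
    have remainder: "fun_op f (H0 + V) - fun_op f H0
        - vector_derivative (\<lambda>t. fun_op f (H0 + t *\<^sub>R V)) (at 0)
        = scaleC_op (f2 a / 2) (V o\<^sub>L V) + Z 1"
      using fun_op[of 0] fun_op[of 1] by (simp add: vector_derivative_at[OF deriv] E_def)
    have f2: "second_derivative f = f2"
      by (simp add: f f2_def second_derivative_comb_fun ts)
    have "continuous_on UNIV f2"
      unfolding f2_def using has_vector_derivative_comb_fun[of "deriv_terms (deriv_terms ts)"] ts
      by (intro continuous_at_imp_continuous_on ballI)
        (auto intro: has_vector_derivative_continuous)
    note dirac = integrable_scaled_dirac[OF this r(1), of a, folded \<nu>]
      integral_scaled_dirac[OF this r(1), of a, folded \<nu>]
    have \<tau>_linear: "\<And>X Y. X \<in> I \<Longrightarrow> Y \<in> I \<Longrightarrow> \<tau> (X + Y) = \<tau> X + \<tau> Y"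
        "\<And>c X. X \<in> I \<Longrightarrow> \<tau> (scaleC_op c X) = c * \<tau> X"
      using assms(5) by (auto simp: trace_on_def)
    have I_closed: "\<And>X Y. X \<in> I \<Longrightarrow> Y \<in> I \<Longrightarrow> X + Y \<in> I"
        "\<And>c X. X \<in> I \<Longrightarrow> scaleC_op c X \<in> I"
      using I by (auto simp: two_sided_ideal_def)
    have "\<tau> (scaleC_op (f2 a / 2) (V o\<^sub>L V) + Z 1) = (\<integral>x. f2 x \<partial>\<nu>)"
      by (simp add: \<tau>_linear I_closed ZI VV dirac(2) r(2))
    then show ?thesis
      unfolding remainder f2 using deriv dirac(1)
      by (auto simp: I_closed ZI VV intro: differentiableI_vector)
  qed
  moreover have "total_variation \<nu> \<le> ennreal r"
    using total_variation_le[of \<nu>] by (simp add: \<nu> space_scale_measure)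
  ultimately show ?thesis
    using VV pos by (simp add: abs_op_square[OF V] r_def)
qed

end
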